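(* Let $n>m\geq 2$ be integers, $d=\gcd(n,m)$, $K$ a field, $S=K[x_1,\ldots,x_n]$, and let $$J_{n,m}=(x_1x_2\cdots x_m,\;x_2\cdots x_{m+1},\;\ldots,\;x_{n-m+1}\cdots x_n,\;x_{n-m+2}\cdots x_nx_1,\;\ldots,\;x_nx_1\cdots x_{m-1})\subset S$$ be the $m$-path ideal of the cycle graph of length $n$. Let $t_0$ be the maximal integer such that $t_0\leq n-1$ and there exists a positive integer $\alpha$ with $mt_0=\alpha n+d$. Then for every integer $t\geq t_0$, $$\operatorname{sdepth}(J_{n,m}^t)\leq\left\lfloor\frac{n+d}{2}\right\rfloor.$$
   Context: Stanley depth: let $S=K[x_1,\ldots,x_n]$ be a polynomial ring over a field $K$ and $M$ a $\mathbb Z^n$-graded $S$-module. A Stanley decomposition of $M$ is a direct sum decomposition $\mathcal D: M=\bigoplus_{i=1}^r m_iK[Z_i]$ as a $\mathbb Z^n$-graded $K$-vector space, where each $m_i\in M$ is homogeneous with respect to the $\mathbb Z^n$-grading, $Z_i\subset\{x_1,\ldots,x_n\}$, and $m_iK[Z_i]=\{um_i: u\in K[Z_i]\}\subset M$ is a free $K[Z_i]$-submodule. Put $\operatorname{sdepth}(\mathcal D)=\min_i|Z_i|$ and $\operatorname{sdepth}(M)=\max\{\operatorname{sdepth}(\mathcal D):\mathcal D$ a Stanley decomposition of $M\}$. The generators of $J_{n,m}$ are the $n$ products of $m$ cyclically consecutive variables; $J_{n,m}^t$ is the ordinary $t$-th power of the ideal. *)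

theory Defs
  imports "HOL-Library.Poly_Mapping" "HOL-Algebra.Ideal_Product" "HOL-Algebra.Module"
begin

section \<open>Polynomial rings\<close>

text \<open>
  A polynomial in the variables \<open>x\<^sub>i\<close>, \<open>i :: nat\<close>, is a finitely supported map from
  exponent vectors to coefficients.  The ring \<open>S = K[x\<^sub>1,\<dots>,x\<^sub>n]\<close> consists of the
  polynomials in which only variables with index in \<open>{1..n}\<close> occur.  A set of variables is
  represented by the set of its indices.
\<close>

type_synonym 'k mpoly = "(nat \<Rightarrow>\<^sub>0 nat) \<Rightarrow>\<^sub>0 'k"

definition mvar :: "nat \<Rightarrow> 'k::field mpoly" where
  "mvar i = Poly_Mapping.single (Poly_Mapping.single i 1) 1"

definition polys_in :: "nat set \<Rightarrow> 'k::field mpoly set" where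
  "polys_in Z = {p. \<forall>e \<in> Poly_Mapping.keys p. Poly_Mapping.keys e \<subseteq> Z}"

definition poly_ring :: "nat \<Rightarrow> 'k::field mpoly ring" where
  "poly_ring n =
    \<lparr>carrier = polys_in {1..n}, mult = (*), one = 1, zero = 0, add = (+)\<rparr>"


section \<open>Graded modules\<close>

text \<open>Internal direct sum \<open>M = \<Oplus>\<^sub>i V\<^sub>i\<close>, possibly with infinitely many summands.\<close>

definition is_direct_sum ::
  "('a, 'm, 'x) module_scheme \<Rightarrow> 'i set \<Rightarrow> ('i \<Rightarrow> 'm set) \<Rightarrow> bool" where
  "is_direct_sum M I V \<longleftrightarrow>
    (\<forall>i\<in>I. additive_subgroup (V i) M) \<and>
    (\<forall>x\<in>carrier M. \<exists>!v. v \<in> (\<Pi>\<^sub>E i\<in>I. V i) \<and> finite {i\<in>I. v i \<noteq> \<zero>\<^bsub>M\<^esub>} \<and>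
        x = finsum M v {i\<in>I. v i \<noteq> \<zero>\<^bsub>M\<^esub>})"

definition Zn :: "nat \<Rightarrow> (nat \<Rightarrow>\<^sub>0 int) set" where
  "Zn n = {a. Poly_Mapping.keys a \<subseteq> {1..n}}"

text \<open>
  The elements of \<open>I\<close> that are homogeneous of multidegree \<open>a\<close>, for \<open>I\<close> the ring \<open>S\<close> or one of
  its ideals: scalar multiples of the monomial with exponent \<open>a\<close>, and only \<open>0\<close> if \<open>a\<close> has a
  negative entry.
\<close>

definition std_grading :: "'k::field mpoly set \<Rightarrow> (nat \<Rightarrow>\<^sub>0 int) \<Rightarrow> 'k mpoly set" where
  "std_grading I a = {p\<in>I. \<forall>e \<in> Poly_Mapping.keys p. Poly_Mapping.map int e = a}"

definition zn_graded_module ::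
  "nat \<Rightarrow> ('k::field mpoly, 'm, 'x) module_scheme \<Rightarrow> ((nat \<Rightarrow>\<^sub>0 int) \<Rightarrow> 'm set) \<Rightarrow> bool" where
  "zn_graded_module n M G \<longleftrightarrow>
    module (poly_ring n :: 'k mpoly ring) M \<and>
    is_direct_sum M (Zn n) G \<and>
    (\<forall>a\<in>Zn n. \<forall>b\<in>Zn n. \<forall>p\<in>std_grading (polys_in {1..n}) a. \<forall>x\<in>G b.
        p \<odot>\<^bsub>M\<^esub> x \<in> G (a + b))"

text \<open>
  An ideal regarded as a module over its ring; the fields \<open>mult\<close> and \<open>one\<close> of the module
  record play no role.
\<close>

definition ideal_module :: "'a ring \<Rightarrow> 'a set \<Rightarrow> ('a, 'a) module" where
  "ideal_module R I =
    \<lparr>carrier = I, mult = mult R, one = one R, zero = zero R, add = add R, smult = mult R\<rparr>"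


section \<open>Stanley depth\<close>

text \<open>
  In the following, \<open>G\<close> is the \<open>\<int>\<^sup>n\<close>-grading of the module \<open>M\<close> over \<open>S = K[x\<^sub>1,\<dots>,x\<^sub>n]\<close>.
\<close>

definition stanley_space ::
  "('k::field mpoly, 'm, 'x) module_scheme \<Rightarrow> 'm \<Rightarrow> nat set \<Rightarrow> 'm set" where
  "stanley_space M m Z = {u \<odot>\<^bsub>M\<^esub> m | u. u \<in> polys_in Z}"

text \<open>
  A decomposition is the list of the pairs \<open>(m\<^sub>i, Z\<^sub>i)\<close>.  The condition on annihilators says
  that \<open>m\<^sub>i K[Z\<^sub>i]\<close> is free with basis \<open>m\<^sub>i\<close>; in particular \<open>m\<^sub>i \<noteq> 0\<close>.  The summands being
  spanned by homogeneous elements, the direct sum is one of graded vector spaces.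
\<close>

definition stanley_decomposition ::
  "nat \<Rightarrow> ('k::field mpoly, 'm, 'x) module_scheme \<Rightarrow> ((nat \<Rightarrow>\<^sub>0 int) \<Rightarrow> 'm set) \<Rightarrow>
    ('m \<times> nat set) list \<Rightarrow> bool" where
  "stanley_decomposition n M G D \<longleftrightarrow>
    (\<forall>(m, Z) \<in> set D. m \<in> carrier M \<and> (\<exists>a\<in>Zn n. m \<in> G a) \<and> Z \<subseteq> {1..n} \<and>
        (\<forall>u\<in>polys_in Z. u \<odot>\<^bsub>M\<^esub> m = \<zero>\<^bsub>M\<^esub> \<longrightarrow> u = 0)) \<and>
    is_direct_sum M {..<length D} (\<lambda>i. stanley_space M (fst (D ! i)) (snd (D ! i)))"

definition sdepth_decomposition :: "('m \<times> nat set) list \<Rightarrow> nat" where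
  "sdepth_decomposition D = Min ((\<lambda>(m, Z). card Z) ` set D)"

text \<open>Meaningful for finitely generated \<open>M \<noteq> 0\<close>, so that the set is nonempty and bounded by \<open>n\<close>.\<close>

definition sdepth ::
  "nat \<Rightarrow> ('k::field mpoly, 'm, 'x) module_scheme \<Rightarrow> ((nat \<Rightarrow>\<^sub>0 int) \<Rightarrow> 'm set) \<Rightarrow> nat" where
  "sdepth n M G = Max {sdepth_decomposition D | D. stanley_decomposition n M G D}"

definition sdepth_ideal :: "nat \<Rightarrow> 'k::field mpoly set \<Rightarrow> nat" where
  "sdepth_ideal n I = sdepth n (ideal_module (poly_ring n) I) (std_grading I)"


section \<open>Path ideals of cycle graphs\<close>

definition cycle_path_gens :: "nat \<Rightarrow> nat \<Rightarrow> 'k::field mpoly set" where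
  "cycle_path_gens n m = {\<Prod>j<m. mvar ((i + j) mod n + 1) | i. i < n}"

definition cycle_path_ideal :: "nat \<Rightarrow> nat \<Rightarrow> 'k::field mpoly set" where
  "cycle_path_ideal n m = genideal (poly_ring n) (cycle_path_gens n m)"

definition ideal_power :: "nat \<Rightarrow> 'k::field mpoly set \<Rightarrow> nat \<Rightarrow> 'k mpoly set" where
  "ideal_power n I t = I [^]\<^bsub>ideals_set (poly_ring n)\<^esub> t"


section \<open>The powers of a path ideal form graded modules\<close>

lemma polys_in_mult: "p \<in> polys_in Z \<Longrightarrow> q \<in> polys_in Z \<Longrightarrow> p * q \<in> polys_in Z"
  unfolding polys_in_def mem_Collect_eq
proof
  fix e
  assume *: "\<forall>e\<in>Poly_Mapping.keys p. Poly_Mapping.keys e \<subseteq> Z"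
    "\<forall>e\<in>Poly_Mapping.keys q. Poly_Mapping.keys e \<subseteq> Z"
  assume "e \<in> Poly_Mapping.keys (p * q)"
  then obtain a b where "e = a + b" "a \<in> Poly_Mapping.keys p" "b \<in> Poly_Mapping.keys q"
    using keys_mult[of p q] by blast
  with * keys_add[of a b] show "Poly_Mapping.keys e \<subseteq> Z" by blast
qed

lemma polys_in_add: "p \<in> polys_in Z \<Longrightarrow> q \<in> polys_in Z \<Longrightarrow> p + q \<in> polys_in Z"
  unfolding polys_in_def using keys_add[of p q] by blast

lemma polys_in_0: "0 \<in> polys_in Z" and polys_in_1: "1 \<in> polys_in Z"
  by (simp_all add: polys_in_def)

lemma poly_ring_simps [simp]:
  "carrier (poly_ring n) = polys_in {1..n}" "mult (poly_ring n) = (*)" "one (poly_ring n) = 1"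
  "zero (poly_ring n) = 0" "add (poly_ring n) = (+)"
  by (auto simp: poly_ring_def)

lemma cring_poly_ring: "cring (poly_ring n :: 'a::field mpoly ring)"
proof (rule cringI)
  show "abelian_group (poly_ring n :: 'a mpoly ring)"
  proof (rule abelian_groupI)
    fix x :: "'a mpoly" assume "x \<in> carrier (poly_ring n)"
    then show "\<exists>y\<in>carrier (poly_ring n). y \<oplus>\<^bsub>poly_ring n\<^esub> x = \<zero>\<^bsub>poly_ring n\<^esub>"
      by (intro bexI[of _ "- x"]) (auto simp: polys_in_def)
  qed (simp_all add: polys_in_add polys_in_0 add_ac)
  show "comm_monoid (poly_ring n :: 'a mpoly ring)"
    by (rule comm_monoidI)
      (simp_all add: polys_in_mult polys_in_1 mult_ac)
qed (simp add: distrib_right)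

lemma mvar_in: "i \<in> Z \<Longrightarrow> mvar i \<in> polys_in Z"
  by (auto simp: mvar_def polys_in_def)

lemma mvar_prod:
  fixes m :: nat
  shows "(\<Prod>j<m. mvar (f j)) = Poly_Mapping.single (\<Sum>j<m. Poly_Mapping.single (f j) 1) (1::'k::field)"
  by (induction m) (auto simp: mvar_def mult_single add_ac)

lemma cycle_path_gens_subset:
  assumes "n > 0" shows "cycle_path_gens n m \<subseteq> polys_in {1..n}"
proof -
  have "(\<Prod>j<m. mvar ((i + j) mod n + 1)) \<in> polys_in {1..n}" for i
  proof (induction m)
    case 0 then show ?case by (auto simp: polys_in_def)
  next
    case (Suc m)
    have "(i + m) mod n + 1 \<in> {1..n}" using assms by (auto simp: Suc_le_eq)
    with Suc show ?case by (simp add: polys_in_mult mvar_in)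
  qed
  then show ?thesis by (auto simp: cycle_path_gens_def)
qed

lemma ideal_poly_ringD:
  assumes "ideal I (poly_ring n)"
  shows "0 \<in> I" "p \<in> I \<Longrightarrow> q \<in> I \<Longrightarrow> p + q \<in> I" "p \<in> I \<Longrightarrow> r \<in> polys_in {1..n} \<Longrightarrow> r * p \<in> I"
    "p \<in> I \<Longrightarrow> - p \<in> I" "I \<subseteq> polys_in {1..n}"
proof -
  interpret ideal I "poly_ring n" by fact
  show 1: "0 \<in> I" "p \<in> I \<Longrightarrow> q \<in> I \<Longrightarrow> p + q \<in> I" "I \<subseteq> polys_in {1..n}"
    using additive_subgroup.zero_closed[OF is_additive_subgroup]
      additive_subgroup.a_closed[OF is_additive_subgroup, of p q]
      additive_subgroup.a_subset[OF is_additive_subgroup] by simp_all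
  show 2: "p \<in> I \<Longrightarrow> r \<in> polys_in {1..n} \<Longrightarrow> r * p \<in> I" for r
    using I_l_closed by simp
  have "- 1 \<in> polys_in {1..n}" by (auto simp: polys_in_def)
  from 2[OF _ this] show "p \<in> I \<Longrightarrow> - p \<in> I" by simp
qed

lemma ideal_sum:
  assumes "ideal I (poly_ring n)" "\<And>i. i \<in> A \<Longrightarrow> f i \<in> I"
  shows "sum f A \<in> I"
  using assms(2) by (induction A rule: infinite_finite_induct)
    (auto intro: ideal_poly_ringD[OF assms(1)])

lemma mpoly_as_sum:
  "p = (\<Sum>e\<in>Poly_Mapping.keys p. Poly_Mapping.single e (Poly_Mapping.lookup p e))"
  by (rule poly_mapping_eqI)
    (auto simp: lookup_sum lookup_single when_def in_keys_iff)

lemma single_sum: "Poly_Mapping.single e (sum f A) = (\<Sum>i\<in>A. Poly_Mapping.single e (f i))"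
  by (induction A rule: infinite_finite_induct) (auto simp: single_add)

lemma polys_in_lookup: "p \<in> polys_in Z \<Longrightarrow> Poly_Mapping.single e (Poly_Mapping.lookup p e) \<in> polys_in Z"
  by (auto simp: polys_in_def in_keys_iff lookup_single when_def split: if_splits)

lemma ideal_term_part:
  assumes I: "ideal I (poly_ring n)"
  shows "ideal {p\<in>polys_in {1..n}. \<forall>e. Poly_Mapping.single e (Poly_Mapping.lookup p e) \<in> I}
           (poly_ring n)" (is "ideal ?T _")
proof -
  interpret R: cring "poly_ring n" by (rule cring_poly_ring)
  note ID = ideal_poly_ringD[OF I]
  have mult: "r * p \<in> ?T" if p: "p \<in> ?T" and r: "r \<in> polys_in {1..n}" for r p
  proof -
    have "Poly_Mapping.single g (Poly_Mapping.lookup (r * p) g) \<in> I" for g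
    proof -
      let ?t = "\<lambda>p e. Poly_Mapping.single e (Poly_Mapping.lookup p e)"
      have "r * p = (\<Sum>e\<in>Poly_Mapping.keys r. \<Sum>f\<in>Poly_Mapping.keys p. ?t r e * ?t p f)"
        by (subst mpoly_as_sum[of r], subst mpoly_as_sum[of p]) (simp add: sum_product)
      then have "?t (r * p) g = (\<Sum>e\<in>Poly_Mapping.keys r. \<Sum>f\<in>Poly_Mapping.keys p.
          Poly_Mapping.single g (Poly_Mapping.lookup (?t r e * ?t p f) g))"
        by (simp add: lookup_sum single_sum)
      also have "\<dots> \<in> I"
      proof (intro ideal_sum[OF I])
        fix e f
        have "?t r e * ?t p f \<in> I"
          using p r ID(3) polys_in_lookup by blast
        then show "Poly_Mapping.single g (Poly_Mapping.lookup (?t r e * ?t p f) g) \<in> I"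
          using ID(1) by (auto simp: mult_single lookup_single when_def)
      qed
      finally show ?thesis .
    qed
    with p r show ?thesis by (auto intro: polys_in_mult)
  qed
  show ?thesis
  proof (rule idealI)
    show "subgroup ?T (add_monoid (poly_ring n))"
    proof (rule R.add.subgroupI)
      show "?T \<noteq> {}" using ID(1) by (auto intro!: exI[of _ 0] simp: polys_in_def)
      fix a assume a: "a \<in> ?T"
      have "- a = (- 1) * a" by simp
      also have "\<dots> \<in> ?T" using a by (intro mult) (auto simp: polys_in_def)
      finally have "- a \<in> ?T" .
      moreover have "\<ominus>\<^bsub>poly_ring n\<^esub> a = - a"
        using a calculation by (intro R.minus_equality) auto
      ultimately show "\<ominus>\<^bsub>poly_ring n\<^esub> a \<in> ?T" by simp
    qed (auto simp: lookup_add single_add intro: polys_in_add ID(2))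
  next
    fix a x :: "'a mpoly" assume *: "a \<in> ?T" "x \<in> carrier (poly_ring n)"
    show "x \<otimes>\<^bsub>poly_ring n\<^esub> a \<in> ?T" using mult[OF *(1)] *(2) by simp
    show "a \<otimes>\<^bsub>poly_ring n\<^esub> x \<in> ?T" using mult[OF *(1)] *(2) by (simp add: mult.commute[of a])
  qed (rule R.ring_axioms)
qed

definition term_closed :: "'k::field mpoly set \<Rightarrow> bool" where
  "term_closed I \<longleftrightarrow> (\<forall>p\<in>I. \<forall>e. Poly_Mapping.single e (Poly_Mapping.lookup p e) \<in> I)"

lemma term_closed_cycle_path_ideal:
  assumes "n > 0"
  shows "ideal (cycle_path_ideal n m :: 'a::field mpoly set) (poly_ring n)"
    "term_closed (cycle_path_ideal n m :: 'a mpoly set)"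
proof -
  interpret R: cring "poly_ring n :: 'a mpoly ring" by (rule cring_poly_ring)
  have sub: "cycle_path_gens n m \<subseteq> carrier (poly_ring n :: 'a mpoly ring)"
    using cycle_path_gens_subset[OF assms] by simp
  show I: "ideal (cycle_path_ideal n m :: 'a mpoly set) (poly_ring n)"
    unfolding cycle_path_ideal_def by (rule R.genideal_ideal[OF sub])
  have gens: "cycle_path_gens n m \<subseteq> (cycle_path_ideal n m :: 'a mpoly set)"
    unfolding cycle_path_ideal_def by (rule R.genideal_self[OF sub])
  let ?T = "{p\<in>polys_in {1..n}. \<forall>e. Poly_Mapping.single e (Poly_Mapping.lookup p e)
               \<in> (cycle_path_ideal n m :: 'a mpoly set)}"
  have "cycle_path_gens n m \<subseteq> ?T"
  proof
    fix p :: "'a mpoly" assume p: "p \<in> cycle_path_gens n m"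
    then obtain i where i: "p = (\<Prod>j<m. mvar ((i + j) mod n + 1))"
      by (auto simp: cycle_path_gens_def)
    obtain f where f: "p = Poly_Mapping.single f 1"
      unfolding i mvar_prod by blast
    have "Poly_Mapping.single e (Poly_Mapping.lookup p e) \<in> cycle_path_ideal n m" for e
      using p gens ideal_poly_ringD(1)[OF I] f by (cases "e = f") (auto simp: lookup_single)
    then show "p \<in> ?T" using p sub by auto
  qed
  then have "cycle_path_ideal n m \<subseteq> ?T"
    unfolding cycle_path_ideal_def[of n m]
    by (intro R.genideal_minimal ideal_term_part) (use I in \<open>auto simp: cycle_path_ideal_def\<close>)
  then show "term_closed (cycle_path_ideal n m :: 'a mpoly set)"
    by (auto simp: term_closed_def)
qed

lemma term_closed_ideal_prod:
  assumes I: "ideal I (poly_ring n)" "term_closed I"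
    and J: "ideal J (poly_ring n)" "term_closed J"
  shows "ideal (ideal_prod (poly_ring n) I J) (poly_ring n)"
    "term_closed (ideal_prod (poly_ring n) I J)"
proof -
  interpret R: cring "poly_ring n" by (rule cring_poly_ring)
  show P: "ideal (ideal_prod (poly_ring n) I J) (poly_ring n)"
    by (rule R.ideal_prod_is_ideal[OF I(1) J(1)])
  let ?t = "\<lambda>p e. Poly_Mapping.single e (Poly_Mapping.lookup p e)"
  have "?t p g \<in> ideal_prod (poly_ring n) I J" if "p \<in> ideal_prod (poly_ring n) I J" for p g
    using that
  proof (induction rule: ideal_prod.induct)
    case (prod r p)
    have "r * p = (\<Sum>e\<in>Poly_Mapping.keys r. \<Sum>f\<in>Poly_Mapping.keys p. ?t r e * ?t p f)"
      by (subst mpoly_as_sum[of r], subst mpoly_as_sum[of p]) (simp add: sum_product)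
    then have "?t (r * p) g = (\<Sum>e\<in>Poly_Mapping.keys r. \<Sum>f\<in>Poly_Mapping.keys p.
        Poly_Mapping.single g (Poly_Mapping.lookup (?t r e * ?t p f) g))"
      by (simp add: lookup_sum single_sum)
    also have "\<dots> \<in> ideal_prod (poly_ring n) I J"
    proof (intro ideal_sum[OF P])
      fix e f
      have "?t r e * ?t p f \<in> ideal_prod (poly_ring n) I J"
        using prod I(2) J(2) ideal_prod.prod[of "?t r e" I "?t p f" J "poly_ring n"]
        by (auto simp: term_closed_def)
      then show "Poly_Mapping.single g (Poly_Mapping.lookup (?t r e * ?t p f) g)
          \<in> ideal_prod (poly_ring n) I J"
        using ideal_poly_ringD(1)[OF P] by (auto simp: mult_single lookup_single when_def)
    qed
    finally show ?case by simp
  next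
    case (sum p q)
    then show ?case by (auto simp: lookup_add single_add intro: ideal_poly_ringD(2)[OF P])
  qed
  then show "term_closed (ideal_prod (poly_ring n) I J)" by (auto simp: term_closed_def)
qed

lemma term_closed_power:
  assumes "n > 0"
  shows "ideal (ideal_power n (cycle_path_ideal n m :: 'a::field mpoly set) t) (poly_ring n) \<and>
    term_closed (ideal_power n (cycle_path_ideal n m :: 'a mpoly set) t)"
proof (induction t)
  case 0
  interpret R: cring "poly_ring n :: 'a mpoly ring" by (rule cring_poly_ring)
  show ?case using R.oneideal
    by (auto simp: ideal_power_def ideals_set_def term_closed_def intro: polys_in_lookup)
next
  case (Suc t)
  have "ideal_power n (cycle_path_ideal n m :: 'a mpoly set) (Suc t) =
    ideal_prod (poly_ring n) (ideal_power n (cycle_path_ideal n m) t) (cycle_path_ideal n m)"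
    by (simp add: ideal_power_def ideals_set_def)
  with Suc term_closed_ideal_prod term_closed_cycle_path_ideal[OF assms] show ?case
    by metis
qed

lemma ideal_module_simps [simp]:
  "carrier (ideal_module R I) = I" "zero (ideal_module R I) = zero R"
  "add (ideal_module R I) = add R" "smult (ideal_module R I) = mult R"
  by (auto simp: ideal_module_def)

lemma module_ideal_module:
  assumes I: "ideal I (poly_ring n)"
  shows "module (poly_ring n) (ideal_module (poly_ring n) I)"
proof (rule moduleI)
  note ID = ideal_poly_ringD[OF I]
  show "abelian_group (ideal_module (poly_ring n) I)"
    by (rule abelian_groupI) (auto simp: add_ac intro: ID, use ID(4) in force)
qed (use ideal_poly_ringD(3,5)[OF I] in \<open>simp_all add: cring_poly_ring distrib_left distrib_right mult.assoc\<close>)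

lemma finsum_ideal_module:
  assumes I: "ideal I (poly_ring n)" and "finite A" "\<And>i. i \<in> A \<Longrightarrow> v i \<in> I"
  shows "finsum (ideal_module (poly_ring n) I) v A = sum v A"
proof -
  interpret M: module "poly_ring n" "ideal_module (poly_ring n) I"
    by (rule module_ideal_module[OF I])
  from assms(2,3) show ?thesis
    by (induction A) (auto simp: Pi_iff)
qed

lemma map_int_inj: "Poly_Mapping.map int e = Poly_Mapping.map int f \<Longrightarrow> e = f"
  by (rule poly_mapping_eqI, drule arg_cong[of _ _ Poly_Mapping.lookup])
    (auto simp: map.rep_eq when_def fun_eq_iff split: if_splits, metis bot_nat_0.not_eq_extremum)

lemma map_int_add: "Poly_Mapping.map int (e + f) = Poly_Mapping.map int e + Poly_Mapping.map int f"
  by (rule poly_mapping_eqI) (auto simp: map.rep_eq lookup_add when_def)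

lemma keys_map_int: "Poly_Mapping.keys (Poly_Mapping.map int e) = Poly_Mapping.keys e"
  by (auto simp: in_keys_iff map.rep_eq when_def split: if_splits)

lemma zn_graded_module_ideal:
  assumes I: "ideal I (poly_ring n)" and "term_closed I"
  shows "zn_graded_module n (ideal_module (poly_ring n) I) (std_grading I)"
  unfolding zn_graded_module_def
proof (intro conjI ballI)
  let ?M = "ideal_module (poly_ring n) I"
  note ID = ideal_poly_ringD[OF I]
  show M: "module (poly_ring n) ?M" by (rule module_ideal_module[OF I])
  then interpret M: module "poly_ring n" ?M .
  show "is_direct_sum ?M (Zn n) (std_grading I)"
    unfolding is_direct_sum_def
  proof (intro conjI ballI)
    fix a
    show "additive_subgroup (std_grading I a) ?M"
    proof (rule additive_subgroup.intro, rule M.add.subgroupI)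
      show "std_grading I a \<noteq> {}" using ID(1) by (auto simp: std_grading_def intro!: exI[of _ 0])
      fix p assume p: "p \<in> std_grading I a"
      have "\<ominus>\<^bsub>?M\<^esub> p = - p"
        using p ID(4) by (intro M.minus_equality) (auto simp: std_grading_def)
      then show "\<ominus>\<^bsub>?M\<^esub> p \<in> std_grading I a" using p ID(4) by (auto simp: std_grading_def)
      fix q assume q: "q \<in> std_grading I a"
      show "p \<oplus>\<^bsub>?M\<^esub> q \<in> std_grading I a"
        using p q ID(2) keys_add[of p q] by (fastforce simp: std_grading_def)
    qed (auto simp: std_grading_def)
  next
    fix x assume x: "x \<in> carrier ?M"
    let ?t = "\<lambda>e. Poly_Mapping.single e (Poly_Mapping.lookup x e)"
    let ?P = "\<lambda>v. v \<in> (\<Pi>\<^sub>E a\<in>Zn n. std_grading I a) \<and> finite {a\<in>Zn n. v a \<noteq> \<zero>\<^bsub>?M\<^esub>} \<and>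
        x = finsum ?M v {a\<in>Zn n. v a \<noteq> \<zero>\<^bsub>?M\<^esub>}"
    have in_Zn: "Poly_Mapping.map int e \<in> Zn n" if "e \<in> Poly_Mapping.keys x" for e
      using that x ID(5) by (simp add: Zn_def keys_map_int polys_in_def) blast
    show "\<exists>!v. ?P v"
    proof (rule ex_ex1I)
      define c where "c a = (\<Sum>e\<in>{e\<in>Poly_Mapping.keys x. Poly_Mapping.map int e = a}. ?t e)" for a
      have c_map: "c (Poly_Mapping.map int e) = ?t e" if "e \<in> Poly_Mapping.keys x" for e
      proof -
        have "{f \<in> Poly_Mapping.keys x. Poly_Mapping.map int f = Poly_Mapping.map int e} = {e}"
          using map_int_inj that by auto
        then show ?thesis by (simp add: c_def)
      qed
      have c0: "c a = 0" if "a \<notin> Poly_Mapping.map int ` Poly_Mapping.keys x" for a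
        unfolding c_def using that by (intro sum.neutral) auto
      have cI: "c a \<in> std_grading I a" for a
      proof (cases "a \<in> Poly_Mapping.map int ` Poly_Mapping.keys x")
        case True
        then obtain e where e: "e \<in> Poly_Mapping.keys x" "a = Poly_Mapping.map int e" by auto
        then show ?thesis using assms(2) x c_map[OF e(1)]
          by (auto simp: std_grading_def term_closed_def split: if_splits)
      qed (auto simp: c0 std_grading_def ID(1))
      define v where "v = restrict c (Zn n)"
      have set: "{a\<in>Zn n. v a \<noteq> \<zero>\<^bsub>?M\<^esub>} = Poly_Mapping.map int ` Poly_Mapping.keys x"
      proof (intro equalityI subsetI)
        fix a assume "a \<in> {a\<in>Zn n. v a \<noteq> \<zero>\<^bsub>?M\<^esub>}"
        then show "a \<in> Poly_Mapping.map int ` Poly_Mapping.keys x"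
          using c0[of a] by (auto simp: v_def split: if_splits)
      next
        fix a assume "a \<in> Poly_Mapping.map int ` Poly_Mapping.keys x"
        then obtain e where e: "e \<in> Poly_Mapping.keys x" "a = Poly_Mapping.map int e" by auto
        have "?t e \<noteq> 0" using e(1) by (metis in_keys_iff lookup_single_eq lookup_zero)
        then show "a \<in> {a\<in>Zn n. v a \<noteq> \<zero>\<^bsub>?M\<^esub>}"
          using e in_Zn c_map by (auto simp: v_def)
      qed
      have "finsum ?M v (Poly_Mapping.map int ` Poly_Mapping.keys x) = sum v (Poly_Mapping.map int ` Poly_Mapping.keys x)"
        using in_Zn cI by (intro finsum_ideal_module[OF I]) (auto simp: v_def std_grading_def)
      also have "\<dots> = (\<Sum>e\<in>Poly_Mapping.keys x. v (Poly_Mapping.map int e))"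
        by (rule sum.reindex_cong[of "Poly_Mapping.map int"])
          (auto intro!: inj_onI dest: map_int_inj)
      also have "\<dots> = (\<Sum>e\<in>Poly_Mapping.keys x. ?t e)"
        by (intro sum.cong) (auto simp: v_def in_Zn c_map)
      also have "\<dots> = x" by (rule mpoly_as_sum[symmetric])
      finally have "?P v" using cI unfolding set by (auto simp: v_def)
      then show "\<exists>v. ?P v" by blast
    next
      have lookup: "Poly_Mapping.lookup (v a) e =
          (if Poly_Mapping.map int e = a then Poly_Mapping.lookup x e else 0)"
        if P: "?P v" and a: "a \<in> Zn n" for v a e
      proof -
        have vI: "v b \<in> std_grading I b" if "b \<in> Zn n" for b using P that by auto
        have off: "Poly_Mapping.lookup (v b) e = 0"
          if "b \<in> Zn n" "Poly_Mapping.map int e \<noteq> b" for b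
          using vI[OF that(1)] that(2) by (auto simp: std_grading_def in_keys_iff)
        show ?thesis
        proof (cases "Poly_Mapping.map int e = a")
          case True
          let ?A = "{a\<in>Zn n. v a \<noteq> 0}"
          have fin: "finite ?A" using P by simp
          have "x = finsum ?M v ?A" using P by simp
          also have "\<dots> = sum v ?A"
            using vI by (intro finsum_ideal_module[OF I fin]) (auto simp: std_grading_def)
          finally have "Poly_Mapping.lookup x e = (\<Sum>b\<in>?A. Poly_Mapping.lookup (v b) e)"
            by (simp add: lookup_sum)
          also have "\<dots> = (\<Sum>b\<in>?A. if b = a then Poly_Mapping.lookup (v a) e else 0)"
            using off True by (intro sum.cong) auto
          also have "\<dots> = Poly_Mapping.lookup (v a) e"
            using fin a by (auto simp: sum.delta)
          finally show ?thesis using True by simp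
        qed (use off a in auto)
      qed
      fix v w assume v: "?P v" and w: "?P w"
      show "v = w"
      proof (rule PiE_ext)
        show "v \<in> (\<Pi>\<^sub>E a\<in>Zn n. std_grading I a)" "w \<in> (\<Pi>\<^sub>E a\<in>Zn n. std_grading I a)"
          using v w by auto
        fix a assume "a \<in> Zn n"
        then show "v a = w a" by (intro poly_mapping_eqI) (simp only: lookup[OF v] lookup[OF w])
      qed
    qed
  qed
next
  fix a b and p x :: "'a mpoly"
  assume p: "p \<in> std_grading (polys_in {1..n}) a" and x: "x \<in> std_grading I b"
  have "p * x \<in> I" using p x ideal_poly_ringD(3)[OF I] by (auto simp: std_grading_def)
  moreover have "Poly_Mapping.map int e = a + b" if "e \<in> Poly_Mapping.keys (p * x)" for e
    using that keys_mult[of p x] p x by (fastforce simp: std_grading_def map_int_add)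
  ultimately show "p \<odot>\<^bsub>ideal_module (poly_ring n) I\<^esub> x \<in> std_grading I (a + b)"
    by (auto simp: std_grading_def)
qed

lemma zn_graded_module_cycle_path_ideal_power:
  assumes "n > 0"
  shows "zn_graded_module n
    (ideal_module (poly_ring n) (ideal_power n (cycle_path_ideal n m) t))
    (std_grading (ideal_power n (cycle_path_ideal n m) t))"
  using term_closed_power[OF assms] zn_graded_module_ideal by blast

end

theory Submission
  imports Defs "HOL-Library.Disjoint_Sets" "HOL-Number_Theory.Cong"
begin

text \<open>
  A Stanley decomposition of a monomial ideal partitions its set of exponents into cells
  \<open>a + \<nat>\<^sup>Z\<close>.  Call a set of vertices a transversal if it meets every class modulo \<open>d\<close> exactly
  once.  Walking around the cycle from class to class shows that, for a suitable monomial
  \<open>w\<close> of degree \<open>mt - d\<close>, the product \<open>w x\<^sub>S\<close> lies in \<open>J\<^sup>t\<close> for every transversal \<open>S\<close>; for degree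
  reasons \<open>w x\<^sub>T\<close> does not for a proper subset \<open>T\<close> of \<open>S\<close>.  As cells are closed under
  componentwise minima, different transversals lie in different cells.  If all \<open>Z\<close> have at
  least \<open>k\<close> elements, the cell of \<open>S\<close> contains \<open>w x\<^sub>S x\<^sub>z\<close> for at least \<open>k - d\<close> of the \<open>n - d\<close>
  vertices \<open>z\<close> outside \<open>S\<close>.  Each set \<open>S \<union> {z}\<close> contains exactly two transversals and is
  taken by the cell of at most one of them, so \<open>2 (k - d) \<le> n - d\<close>.
\<close>

section \<open>Monomial ideals and their exponents\<close>

text \<open>The powers of the path ideal, the rings \<open>K[Z]\<close> and the Stanley spaces all
  have this form, so every statement about them becomes one about sets of exponents.\<close>

definition span_exps :: "(nat \<Rightarrow>\<^sub>0 nat) set \<Rightarrow> 'k::field mpoly set" where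
  "span_exps U = {p. Poly_Mapping.keys p \<subseteq> U}"

definition exps_in :: "nat set \<Rightarrow> (nat \<Rightarrow>\<^sub>0 nat) set" where
  "exps_in Z = {e. Poly_Mapping.keys e \<subseteq> Z}"

definition exp_cell :: "(nat \<Rightarrow>\<^sub>0 nat) \<Rightarrow> nat set \<Rightarrow> (nat \<Rightarrow>\<^sub>0 nat) set" where
  "exp_cell a Z = {a + f | f. f \<in> exps_in Z}"

lemma polys_in_eq_span: "polys_in Z = span_exps (exps_in Z)"
  by (auto simp: polys_in_def span_exps_def exps_in_def)

lemma exps_in_add: "e \<in> exps_in Z \<Longrightarrow> f \<in> exps_in Z \<Longrightarrow> e + f \<in> exps_in Z"
  unfolding exps_in_def using keys_add[of e f] by blast

lemma span_exps_single: "e \<in> U \<Longrightarrow> Poly_Mapping.single e c \<in> span_exps U"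
  by (auto simp: span_exps_def)

lemma span_exps_0: "0 \<in> span_exps U"
  by (simp add: span_exps_def)

lemma span_exps_add: "p \<in> span_exps U \<Longrightarrow> q \<in> span_exps U \<Longrightarrow> p + q \<in> span_exps U"
  unfolding span_exps_def using keys_add[of p q] by blast

lemma span_exps_mult:
  "p \<in> span_exps A \<Longrightarrow> q \<in> span_exps B \<Longrightarrow> p * q \<in> span_exps {a + b | a b. a \<in> A \<and> b \<in> B}"
  unfolding span_exps_def using keys_mult[of p q] by blast

lemma span_exps_sum: "(\<And>i. i \<in> A \<Longrightarrow> f i \<in> span_exps U) \<Longrightarrow> sum f A \<in> span_exps U"
  by (induction A rule: infinite_finite_induct) (auto intro: span_exps_add span_exps_0)

lemma span_exps_mono: "U \<subseteq> V \<Longrightarrow> span_exps U \<subseteq> span_exps V"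
  by (auto simp: span_exps_def)

lemma ideal_span_exps:
  assumes U: "U \<subseteq> exps_in {1..n}"
    and up: "\<And>e f. e \<in> U \<Longrightarrow> f \<in> exps_in {1..n} \<Longrightarrow> e + f \<in> U"
  shows "ideal (span_exps U) (poly_ring n :: 'k::field mpoly ring)"
proof -
  interpret R: cring "poly_ring n :: 'k mpoly ring" by (rule cring_poly_ring)
  have mult: "a * x \<in> span_exps U"
    if "a \<in> span_exps U" "x \<in> polys_in {1..n}" for a x :: "'k mpoly"
  proof -
    have "a * x \<in> span_exps {e + f | e f. e \<in> U \<and> f \<in> exps_in {1..n}}"
      using that by (intro span_exps_mult) (auto simp: polys_in_eq_span)
    also have "\<dots> \<subseteq> span_exps U" using up by (intro span_exps_mono) auto
    finally show ?thesis .
  qed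
  have sub: "span_exps U \<subseteq> (polys_in {1..n} :: 'k mpoly set)"
    unfolding polys_in_eq_span using U by (rule span_exps_mono)
  show ?thesis
  proof (rule idealI)
    show "subgroup (span_exps U) (add_monoid (poly_ring n :: 'k mpoly ring))"
    proof (rule R.add.subgroupI)
      fix a :: "'k mpoly" assume a: "a \<in> span_exps U"
      have "- a \<in> span_exps U" using a by (simp add: span_exps_def)
      moreover have "\<ominus>\<^bsub>poly_ring n\<^esub> a = - a"
        using a calculation sub by (intro R.minus_equality) auto
      ultimately show "\<ominus>\<^bsub>poly_ring n\<^esub> a \<in> span_exps U" by simp
    qed (use sub span_exps_0 in \<open>auto intro: span_exps_add\<close>)
  next
    fix a x :: "'k mpoly" assume *: "a \<in> span_exps U" "x \<in> carrier (poly_ring n)"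
    show "a \<otimes>\<^bsub>poly_ring n\<^esub> x \<in> span_exps U" using mult * by simp
    then show "x \<otimes>\<^bsub>poly_ring n\<^esub> a \<in> span_exps U" by (simp add: mult.commute)
  qed (rule R.ring_axioms)
qed

lemma span_exps_subset_ideal:
  fixes I :: "'k::field mpoly set"
  assumes "ideal I (poly_ring n)" and "\<And>e c. e \<in> U \<Longrightarrow> Poly_Mapping.single e c \<in> I"
  shows "span_exps U \<subseteq> I"
proof
  fix p :: "'k mpoly" assume p: "p \<in> span_exps U"
  show "p \<in> I"
    by (subst mpoly_as_sum, rule ideal_sum[OF assms(1)]) (use p assms(2) in \<open>auto simp: span_exps_def\<close>)
qed

text \<open>Supports of products lie in the sumset, and a single term with exponent
  \<open>a + b\<close> splits into a product of two terms.\<close>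

lemma ideal_prod_span_exps:
  assumes A: "ideal (span_exps A :: 'k::field mpoly set) (poly_ring n)"
    and B: "ideal (span_exps B :: 'k mpoly set) (poly_ring n)"
  shows "ideal_prod (poly_ring n) (span_exps A) (span_exps B :: 'k mpoly set)
    = span_exps {a + b | a b. a \<in> A \<and> b \<in> B}"
proof (intro equalityI subsetI)
  fix p :: "'k mpoly" assume "p \<in> ideal_prod (poly_ring n) (span_exps A) (span_exps B)"
  then show "p \<in> span_exps {a + b | a b. a \<in> A \<and> b \<in> B}"
    by (induction rule: ideal_prod.induct) (auto intro: span_exps_mult span_exps_add)
next
  interpret R: cring "poly_ring n :: 'k mpoly ring" by (rule cring_poly_ring)
  let ?P = "ideal_prod (poly_ring n) (span_exps A) (span_exps B) :: 'k mpoly set"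
  have "span_exps {a + b | a b. a \<in> A \<and> b \<in> B} \<subseteq> ?P"
  proof (rule span_exps_subset_ideal)
    show "ideal ?P (poly_ring n)" by (rule R.ideal_prod_is_ideal[OF A B])
    fix e and c :: 'k assume "e \<in> {a + b | a b. a \<in> A \<and> b \<in> B}"
    then obtain a b where ab: "e = a + b" "a \<in> A" "b \<in> B" by blast
    have "Poly_Mapping.single e c = Poly_Mapping.single a c * Poly_Mapping.single b 1"
      by (simp add: ab(1) mult_single)
    also have "\<dots> \<in> ?P"
      using ab(2,3) ideal_prod.prod[of "Poly_Mapping.single a c" "span_exps A"
          "Poly_Mapping.single b 1" "span_exps B" "poly_ring n"]
      by (simp add: span_exps_single)
    finally show "Poly_Mapping.single e c \<in> ?P" .
  qed
  then show "p \<in> ?P" if "p \<in> span_exps {a + b | a b. a \<in> A \<and> b \<in> B}" for p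
    using that by blast
qed

text \<open>Position \<open>a\<close> stands for the vertex \<open>a mod n + 1\<close>. Start and
  length are unbounded, so that walks can be concatenated and may pass a vertex repeatedly; for
  \<open>l = m\<close> this is the exponent of a generator.\<close>

definition walk :: "nat \<Rightarrow> nat \<Rightarrow> nat \<Rightarrow> (nat \<Rightarrow>\<^sub>0 nat)" where
  "walk n a l = (\<Sum>j<l. Poly_Mapping.single ((a + j) mod n + 1) 1)"

text \<open>Starting from all exponents in \<open>{1..n}\<close> instead of only \<open>0\<close>
  builds in the multiples of the products of generators, so each set is closed upwards.\<close>

primrec power_exps :: "nat \<Rightarrow> nat \<Rightarrow> nat \<Rightarrow> (nat \<Rightarrow>\<^sub>0 nat) set" where
  "power_exps n m 0 = exps_in {1..n}"
| "power_exps n m (Suc t) = {e + walk n i m | e i. e \<in> power_exps n m t}"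

lemma lookup_walk: "Poly_Mapping.lookup (walk n a l) i = card {j. j < l \<and> (a + j) mod n + 1 = i}"
proof -
  have "Poly_Mapping.lookup (walk n a l) i = (\<Sum>j<l. if (a + j) mod n + 1 = i then 1 else 0)"
    by (auto simp: walk_def lookup_sum lookup_single when_def intro!: sum.cong)
  also have "\<dots> = card ({..<l} \<inter> {j. (a + j) mod n + 1 = i})"
    by (subst sum.If_cases) auto
  also have "{..<l} \<inter> {j. (a + j) mod n + 1 = i} = {j. j < l \<and> (a + j) mod n + 1 = i}" by auto
  finally show ?thesis .
qed

lemma walk_mod: "walk n (a mod n) l = walk n a l"
  by (simp add: walk_def mod_add_left_eq)

lemma walk_add: "walk n a (k + l) = walk n a k + walk n (a + k) l"
  by (induction l) (simp_all add: walk_def add_ac)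

lemma walk_in: "n > 0 \<Longrightarrow> walk n a l \<in> exps_in {1..n}"
  unfolding walk_def
proof (induction l)
  case (Suc l)
  have "Poly_Mapping.single ((a + l) mod n + 1) 1 \<in> exps_in {1..n}"
    using Suc.prems by (simp add: exps_in_def Suc_le_eq)
  with Suc show ?case by (simp add: exps_in_add del: One_nat_def)
qed (simp add: exps_in_def)

lemma power_exps_subset: "n > 0 \<Longrightarrow> power_exps n m t \<subseteq> exps_in {1..n}"
  by (induction t) (auto simp del: One_nat_def intro!: exps_in_add walk_in)

lemma power_exps_up:
  "e \<in> power_exps n m t \<Longrightarrow> f \<in> exps_in {1..n} \<Longrightarrow> e + f \<in> power_exps n m t"
proof (induction t arbitrary: e)
  case (Suc t)
  then obtain e' i where e': "e = e' + walk n i m" "e' \<in> power_exps n m t" by auto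
  have "e + f = (e' + f) + walk n i m" by (simp add: e'(1) add_ac)
  with Suc.IH[OF e'(2) Suc.prems(2)] show ?case by auto
qed (auto intro: exps_in_add)

lemma ideal_span_power_exps:
  "n > 0 \<Longrightarrow> ideal (span_exps (power_exps n m t) :: 'k::field mpoly set) (poly_ring n)"
  by (intro ideal_span_exps power_exps_subset power_exps_up)

lemma cycle_path_gens_eq:
  assumes "n > 0"
  shows "cycle_path_gens n m = (range (\<lambda>i. Poly_Mapping.single (walk n i m) 1) :: 'k::field mpoly set)"
proof -
  have "cycle_path_gens n m = ((\<lambda>i. Poly_Mapping.single (walk n i m) 1) ` {..<n} :: 'k mpoly set)"
    by (auto simp: cycle_path_gens_def mvar_prod walk_def)
  also have "\<dots> = range (\<lambda>i. Poly_Mapping.single (walk n i m) 1)"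
  proof (intro equalityI subsetI)
    fix p :: "'k mpoly" assume "p \<in> range (\<lambda>i. Poly_Mapping.single (walk n i m) 1)"
    then obtain i where "p = Poly_Mapping.single (walk n (i mod n) m) 1" by (auto simp: walk_mod)
    then show "p \<in> (\<lambda>i. Poly_Mapping.single (walk n i m) 1) ` {..<n}" using assms by auto
  qed auto
  finally show ?thesis .
qed

lemma cycle_path_ideal_eq:
  assumes n: "n > 0"
  shows "cycle_path_ideal n m = (span_exps (power_exps n m 1) :: 'k::field mpoly set)"
proof
  interpret R: cring "poly_ring n :: 'k mpoly ring" by (rule cring_poly_ring)
  let ?I = "cycle_path_ideal n m :: 'k mpoly set"
  have sub: "cycle_path_gens n m \<subseteq> carrier (poly_ring n :: 'k mpoly ring)"
    using cycle_path_gens_subset[OF n] by simp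
  have I: "ideal ?I (poly_ring n)" by (rule term_closed_cycle_path_ideal[OF n])
  have "0 + walk n i m \<in> power_exps n m 1" for i
    by (force simp del: add_0 simp: exps_in_def)
  then show "?I \<subseteq> span_exps (power_exps n m 1)"
    unfolding cycle_path_ideal_def cycle_path_gens_eq[OF n]
    by (intro R.genideal_minimal ideal_span_power_exps[OF n]) (auto intro!: span_exps_single)
  show "span_exps (power_exps n m 1) \<subseteq> ?I"
  proof (rule span_exps_subset_ideal[OF I])
    fix e and c :: 'k assume "e \<in> power_exps n m 1"
    then obtain f i where e: "e = f + walk n i m" "f \<in> exps_in {1..n}" by auto
    have "Poly_Mapping.single (walk n i m) (1::'k) \<in> ?I"
      unfolding cycle_path_ideal_def using R.genideal_self[OF sub]
      by (auto simp: cycle_path_gens_eq[OF n])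
    then have "Poly_Mapping.single f c * Poly_Mapping.single (walk n i m) 1 \<in> ?I"
      using e(2) by (intro ideal_poly_ringD(3)[OF I]) (auto simp: polys_in_eq_span intro: span_exps_single)
    then show "Poly_Mapping.single e c \<in> ?I" by (simp add: e(1) mult_single)
  qed
qed

text \<open>The cofactor of the last generator is absorbed into the previous power, whose exponents
  are closed upwards.\<close>

lemma ideal_power_eq:
  assumes n: "n > 0"
  shows "ideal_power n (cycle_path_ideal n m :: 'k::field mpoly set) t = span_exps (power_exps n m t)"
proof (induction t)
  case 0
  show ?case by (simp add: ideal_power_def ideals_set_def polys_in_eq_span)
next
  case (Suc t)
  have "ideal_power n (cycle_path_ideal n m :: 'k mpoly set) (Suc t) =
    ideal_prod (poly_ring n) (ideal_power n (cycle_path_ideal n m) t) (cycle_path_ideal n m)"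
    by (simp add: ideal_power_def ideals_set_def)
  also have "\<dots> = ideal_prod (poly_ring n) (span_exps (power_exps n m t)) (span_exps (power_exps n m 1))"
    unfolding Suc by (simp only: cycle_path_ideal_eq[OF n])
  also have "\<dots> = span_exps {a + b | a b. a \<in> power_exps n m t \<and> b \<in> power_exps n m 1}"
    using n by (intro ideal_prod_span_exps ideal_span_power_exps)
  also have "{a + b | a b. a \<in> power_exps n m t \<and> b \<in> power_exps n m 1} = power_exps n m (Suc t)"
  proof (intro equalityI subsetI)
    fix e assume "e \<in> {a + b | a b. a \<in> power_exps n m t \<and> b \<in> power_exps n m 1}"
    then obtain a f i where "e = (a + f) + walk n i m" "a \<in> power_exps n m t" "f \<in> exps_in {1..n}"
      by (auto simp: add_ac)
    then show "e \<in> power_exps n m (Suc t)" using power_exps_up by auto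
  next
    fix e assume "e \<in> power_exps n m (Suc t)"
    then obtain a i where e: "e = a + walk n i m" "a \<in> power_exps n m t" by auto
    have "0 + walk n i m \<in> power_exps n m 1"
      by (force simp del: add_0 simp: exps_in_def)
    with e show "e \<in> {a + b | a b. a \<in> power_exps n m t \<and> b \<in> power_exps n m 1}" by auto
  qed
  finally show ?case .
qed

section \<open>Stanley decompositions as partitions of exponent sets\<close>

text \<open>This coordinatewise form makes it visible that a cell is closed under componentwise
  minima and under raising coordinates in \<open>Z\<close>.\<close>

lemma exp_cell_iff:
  "e \<in> exp_cell a Z \<longleftrightarrow> (\<forall>j. Poly_Mapping.lookup a j \<le> Poly_Mapping.lookup e j \<and>
     (j \<notin> Z \<longrightarrow> Poly_Mapping.lookup e j = Poly_Mapping.lookup a j))"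
proof
  assume "e \<in> exp_cell a Z"
  then obtain f where f: "e = a + f" "Poly_Mapping.keys f \<subseteq> Z" by (auto simp: exp_cell_def exps_in_def)
  have "Poly_Mapping.lookup f j = 0" if "j \<notin> Z" for j
    using that f(2) by (auto simp: in_keys_iff)
  then show "\<forall>j. Poly_Mapping.lookup a j \<le> Poly_Mapping.lookup e j \<and>
     (j \<notin> Z \<longrightarrow> Poly_Mapping.lookup e j = Poly_Mapping.lookup a j)"
    by (simp add: f(1) lookup_add)
next
  assume *: "\<forall>j. Poly_Mapping.lookup a j \<le> Poly_Mapping.lookup e j \<and>
     (j \<notin> Z \<longrightarrow> Poly_Mapping.lookup e j = Poly_Mapping.lookup a j)"
  then have "e = a + (e - a)"
    by (intro poly_mapping_eqI) (simp add: lookup_add lookup_minus)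
  moreover have "Poly_Mapping.keys (e - a) \<subseteq> Z"
  proof
    fix j assume "j \<in> Poly_Mapping.keys (e - a)"
    then show "j \<in> Z" using * by (auto simp: in_keys_iff lookup_minus)
  qed
  ultimately show "e \<in> exp_cell a Z" unfolding exp_cell_def exps_in_def by blast
qed

lemma stanley_space_monomial:
  fixes c :: "'k::field"
  assumes "c \<noteq> 0"
  shows "stanley_space (ideal_module (poly_ring n) I) (Poly_Mapping.single a c) Z = span_exps (exp_cell a Z)"
proof (intro equalityI subsetI)
  fix p assume "p \<in> stanley_space (ideal_module (poly_ring n) I) (Poly_Mapping.single a c) Z"
  then obtain u where u: "p = u * Poly_Mapping.single a c" "u \<in> polys_in Z"
    by (auto simp: stanley_space_def)
  have "p \<in> span_exps {e + f | e f. e \<in> exps_in Z \<and> f \<in> {a}}"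
    unfolding u(1) using u(2) by (intro span_exps_mult) (auto simp: polys_in_eq_span span_exps_single)
  also have "{e + f | e f. e \<in> exps_in Z \<and> f \<in> {a}} = exp_cell a Z"
    by (auto simp: exp_cell_def add_ac)
  finally show "p \<in> span_exps (exp_cell a Z)" .
next
  fix p :: "'k mpoly" assume p: "p \<in> span_exps (exp_cell a Z)"
  \<comment> \<open>\<open>u\<close> is the quotient of \<open>p\<close> by the monomial. Truncated
    subtraction of exponents is harmless, since every exponent in the cell is at least
    \<open>a\<close>.\<close>
  define u where "u = (\<Sum>e\<in>Poly_Mapping.keys p. Poly_Mapping.single (e - a) (Poly_Mapping.lookup p e / c))"
  have *: "e - a \<in> exps_in Z" "e - a + a = e" if "e \<in> Poly_Mapping.keys p" for e
    using that p by (auto simp: span_exps_def exp_cell_def add_ac)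
  have "u \<in> polys_in Z"
    unfolding polys_in_eq_span u_def using * by (intro span_exps_sum span_exps_single)
  moreover have "u * Poly_Mapping.single a c = p"
    by (subst (2) mpoly_as_sum, unfold u_def sum_distrib_right, intro sum.cong)
      (use * assms in \<open>simp_all add: mult_single\<close>)
  ultimately show "p \<in> stanley_space (ideal_module (poly_ring n) I) (Poly_Mapping.single a c) Z"
    by (auto simp: stanley_space_def)
qed

definition restrict_exps :: "(nat \<Rightarrow>\<^sub>0 nat) set \<Rightarrow> 'k::field mpoly \<Rightarrow> 'k mpoly" where
  "restrict_exps C p = (\<Sum>e\<in>Poly_Mapping.keys p \<inter> C. Poly_Mapping.single e (Poly_Mapping.lookup p e))"

lemma lookup_restrict_exps:
  "Poly_Mapping.lookup (restrict_exps C p) e = (if e \<in> C then Poly_Mapping.lookup p e else 0)"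
  by (auto simp: restrict_exps_def lookup_sum lookup_single when_def in_keys_iff sum.delta)

text \<open>Monomials form a basis: one outside all \<open>C i\<close> has no representation, one in
  two of them has two. For a partition, the component of \<open>x\<close> in summand
  \<open>i\<close> can only be the part of \<open>x\<close> supported on \<open>C i\<close>.\<close>

lemma direct_sum_span_iff:
  fixes C :: "nat \<Rightarrow> (nat \<Rightarrow>\<^sub>0 nat) set"
  assumes I: "ideal (span_exps U :: 'k::field mpoly set) (poly_ring n)"
  shows "is_direct_sum (ideal_module (poly_ring n) (span_exps U :: 'k mpoly set)) {..<l} (\<lambda>i. span_exps (C i))
    \<longleftrightarrow> (\<Union>i<l. C i) = U \<and> disjoint_family_on C {..<l}"
proof -
  let ?M = "ideal_module (poly_ring n) (span_exps U :: 'k mpoly set)"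
  interpret M: module "poly_ring n" ?M by (rule module_ideal_module[OF I])
  let ?P = "\<lambda>x v. v \<in> (\<Pi>\<^sub>E i\<in>{..<l}. span_exps (C i)) \<and> finite {i\<in>{..<l}. v i \<noteq> \<zero>\<^bsub>?M\<^esub>} \<and>
        x = finsum ?M v {i\<in>{..<l}. v i \<noteq> \<zero>\<^bsub>?M\<^esub>}"
  have sum_eq: "finsum ?M v {i\<in>{..<l}. v i \<noteq> \<zero>\<^bsub>?M\<^esub>} = sum v {..<l}"
    if "\<And>i. i < l \<Longrightarrow> v i \<in> span_exps U" for v
  proof -
    have "finsum ?M v {i\<in>{..<l}. v i \<noteq> \<zero>\<^bsub>?M\<^esub>} = sum v {i\<in>{..<l}. v i \<noteq> \<zero>\<^bsub>?M\<^esub>}"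
      using that by (intro finsum_ideal_module[OF I]) auto
    also have "\<dots> = sum v {..<l}" by (intro sum.mono_neutral_left) auto
    finally show ?thesis .
  qed
  show ?thesis
  proof
    assume D: "is_direct_sum ?M {..<l} (\<lambda>i. span_exps (C i))"
    have sub: "C i \<subseteq> U" if "i < l" for i
    proof
      fix e assume "e \<in> C i"
      then have "Poly_Mapping.single e (1::'k) \<in> span_exps (C i)" by (rule span_exps_single)
      moreover have "span_exps (C i) \<subseteq> carrier ?M"
        using D that unfolding is_direct_sum_def by (blast dest: additive_subgroup.a_subset)
      ultimately have "Poly_Mapping.single e (1::'k) \<in> span_exps U" by auto
      then show "e \<in> U" by (simp add: span_exps_def)
    qed
    have ex1: "\<exists>!v. ?P x v" if "x \<in> span_exps U" for x
      using D that unfolding is_direct_sum_def by simp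
    have in_U: "v i \<in> span_exps U" if "?P x v" "i < l" for x v i
    proof -
      have "v i \<in> span_exps (C i)" using that unfolding PiE_iff by blast
      then show ?thesis using span_exps_mono[OF sub[OF that(2)]] by blast
    qed
    \<comment> \<open>Some component of the monomial must have a nonzero coefficient at
      \<open>e\<close>, which puts \<open>e\<close> into the corresponding
      \<open>C i\<close>.\<close>
    have cover: "e \<in> (\<Union>i<l. C i)" if e: "e \<in> U" for e
    proof -
      obtain v where v: "?P (Poly_Mapping.single e (1::'k)) v"
        using ex1[OF span_exps_single[OF e]] by blast
      have "Poly_Mapping.single e (1::'k) = sum v {..<l}" using v sum_eq[of v] in_U[OF v] by simp
      then have "(\<Sum>i<l. Poly_Mapping.lookup (v i) e) = Poly_Mapping.lookup (Poly_Mapping.single e (1::'k)) e"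
        by (simp only: lookup_sum)
      also have "\<dots> = 1" by simp
      finally obtain i where i: "i < l" "Poly_Mapping.lookup (v i) e \<noteq> 0"
        by (metis lessThan_iff sum.neutral zero_neq_one)
      moreover have "v i \<in> span_exps (C i)" using v i(1) by (auto simp: PiE_iff)
      ultimately show ?thesis by (auto simp: span_exps_def in_keys_iff)
    qed
    have disj: "C i \<inter> C j = {}" if "i < l" "j < l" "i \<noteq> j" for i j
    proof (rule ccontr)
      assume "C i \<inter> C j \<noteq> {}"
      then obtain e where e: "e \<in> C i" "e \<in> C j" by blast
      let ?x = "Poly_Mapping.single e (1::'k)"
      \<comment> \<open>\<open>?v k\<close> places the whole monomial in summand \<open>k\<close>;
        the choices \<open>k = i\<close> and \<open>k = j\<close> contradict uniqueness.\<close>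
      let ?v = "\<lambda>k. restrict (\<lambda>k'. if k' = k then ?x else 0) {..<l}"
      have v: "?P ?x (?v k)" if "k < l" "e \<in> C k" for k
      proof -
        have V: "?v k \<in> (\<Pi>\<^sub>E i\<in>{..<l}. span_exps (C i))"
          using that by (auto intro: span_exps_single span_exps_0)
        have "?v k k' \<in> span_exps U" if "k' < l" for k'
          using \<open>e \<in> C k\<close> sub[of k'] span_exps_0 that by (auto intro: span_exps_single)
        from sum_eq[of "?v k", OF this]
        have "finsum ?M (?v k) {i\<in>{..<l}. ?v k i \<noteq> \<zero>\<^bsub>?M\<^esub>} = sum (?v k) {..<l}" .
        also have "\<dots> = (\<Sum>k'<l. if k' = k then ?x else 0)" by (rule sum.cong) auto
        also have "\<dots> = ?x" using that(1) by simp
        finally show ?thesis using V by simp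
      qed
      have "?x \<in> span_exps U" using sub[OF that(1)] e(1) by (auto intro: span_exps_single)
      from ex1[OF this] v[OF that(1) e(1)] v[OF that(2) e(2)] have "?v i = ?v j" by blast
      then have "?v i i = ?v j i" by (rule arg_cong)
      then have "?x = 0" using that by simp
      then show False by (metis lookup_single_eq lookup_zero zero_neq_one)
    qed
    show "(\<Union>i<l. C i) = U \<and> disjoint_family_on C {..<l}"
      using sub cover disj unfolding disjoint_family_on_def by blast
  next
    assume *: "(\<Union>i<l. C i) = U \<and> disjoint_family_on C {..<l}"
    then have sub: "C i \<subseteq> U" if "i < l" for i using that by blast
    have disj: "i = j" if "i < l" "j < l" "e \<in> C i" "e \<in> C j" for i j e
      using * that by (auto simp: disjoint_family_on_def)
    show "is_direct_sum ?M {..<l} (\<lambda>i. span_exps (C i))"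
      unfolding is_direct_sum_def
    proof (intro conjI ballI)
      fix i assume "i \<in> {..<l}"
      then have CU: "span_exps (C i) \<subseteq> (span_exps U :: 'k mpoly set)"
        using sub by (intro span_exps_mono) auto
      show "additive_subgroup (span_exps (C i)) ?M"
      proof (rule additive_subgroup.intro, rule M.add.subgroupI)
        fix p :: "'k mpoly" assume p: "p \<in> span_exps (C i)"
        then have m: "- p \<in> span_exps (C i)" by (simp add: span_exps_def)
        have "\<ominus>\<^bsub>?M\<^esub> p = - p" using p m CU by (intro M.minus_equality) auto
        with m show "\<ominus>\<^bsub>?M\<^esub> p \<in> span_exps (C i)" by simp
      qed (use CU span_exps_0 in \<open>auto intro: span_exps_add\<close>)
    next
      fix x assume x: "x \<in> carrier ?M"
      have in_U: "v i \<in> span_exps U" if "v \<in> (\<Pi>\<^sub>E i\<in>{..<l}. span_exps (C i))" "i < l"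
        for v :: "nat \<Rightarrow> 'k mpoly" and i
      proof -
        have "v i \<in> span_exps (C i)" using that unfolding PiE_iff by blast
        then show ?thesis using span_exps_mono[OF sub[OF that(2)]] by blast
      qed
      show "\<exists>!v. ?P x v"
      proof (rule ex_ex1I)
        define v where "v = restrict (\<lambda>i. restrict_exps (C i) x) {..<l}"
        have v: "v \<in> (\<Pi>\<^sub>E i\<in>{..<l}. span_exps (C i))"
          unfolding v_def restrict_exps_def by (auto intro!: span_exps_sum span_exps_single)
        have "x = sum v {..<l}"
        proof (rule poly_mapping_eqI)
          fix e
          have eq: "Poly_Mapping.lookup (sum v {..<l}) e = (\<Sum>i<l. if e \<in> C i then Poly_Mapping.lookup x e else 0)"
            unfolding lookup_sum by (intro sum.cong) (auto simp: v_def lookup_restrict_exps)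
          show "Poly_Mapping.lookup x e = Poly_Mapping.lookup (sum v {..<l}) e"
          proof (cases "e \<in> U")
            case True
            then obtain i where i: "i < l" "e \<in> C i" using * by blast
            have "(\<Sum>i<l. if e \<in> C i then Poly_Mapping.lookup x e else 0) =
              (\<Sum>j<l. if j = i then Poly_Mapping.lookup x e else 0)"
              using i disj by (intro sum.cong) auto
            then show ?thesis using i(1) by (simp add: eq)
          next
            case False
            then have "Poly_Mapping.lookup x e = 0"
              using x by (auto simp: span_exps_def in_keys_iff)
            then show ?thesis by (simp add: eq cong: if_cong)
          qed
        qed
        then have "?P x v" using v sum_eq[of v] in_U[OF v] by simp
        then show "\<exists>v. ?P x v" by blast
      next
        \<comment> \<open>By disjointness only one component can contribute at \<open>e\<close>, so
          the coefficients of every representation are dictated by \<open>x\<close>.\<close>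
        have lookup: "Poly_Mapping.lookup (v i) e = (if e \<in> C i then Poly_Mapping.lookup x e else 0)"
          if P: "?P x v" and i: "i < l" for v i e
        proof -
          have x: "x = sum v {..<l}" using P sum_eq[of v] in_U[of v] by simp
          have off: "Poly_Mapping.lookup (v j) e = 0" if "j < l" "e \<notin> C j" for j
          proof -
            have "v j \<in> span_exps (C j)" using P that(1) unfolding PiE_iff by blast
            then show ?thesis using that(2) by (auto simp: span_exps_def in_keys_iff)
          qed
          have "Poly_Mapping.lookup x e = Poly_Mapping.lookup (v i) e" if "e \<in> C i"
          proof -
            have "Poly_Mapping.lookup x e = (\<Sum>j<l. Poly_Mapping.lookup (v j) e)"
              by (simp add: x lookup_sum)
            also have "\<dots> = (\<Sum>j<l. if j = i then Poly_Mapping.lookup (v i) e else 0)"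
              using off disj[OF i _ that] by (intro sum.cong) auto
            finally show ?thesis using i by simp
          qed
          then show ?thesis using off[OF i] by auto
        qed
        fix v w assume v: "?P x v" and w: "?P x w"
        show "v = w"
        proof (rule PiE_ext)
          show "v \<in> (\<Pi>\<^sub>E i\<in>{..<l}. span_exps (C i))" "w \<in> (\<Pi>\<^sub>E i\<in>{..<l}. span_exps (C i))"
            using v w by auto
          fix i assume "i \<in> {..<l}"
          then show "v i = w i"
            by (intro poly_mapping_eqI) (simp only: lookup[OF v] lookup[OF w] lessThan_iff)
        qed
      qed
    qed
  qed
qed

lemma is_direct_sum_cong:
  assumes "\<And>i. i \<in> I \<Longrightarrow> V i = W i"
  shows "is_direct_sum M I V = is_direct_sum M I W"
proof -
  have "(\<Pi>\<^sub>E i\<in>I. V i) = (\<Pi>\<^sub>E i\<in>I. W i)" using assms by (intro PiE_cong) auto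
  then show ?thesis using assms by (simp add: is_direct_sum_def)
qed

text \<open>Each multidegree of the ideal has dimension at most one, so a nonzero homogeneous
  generator is a scalar multiple of a monomial and its Stanley space is spanned by a cell.\<close>

lemma stanley_decomposition_exps:
  fixes D :: "('k::field mpoly \<times> nat set) list"
  assumes I: "ideal (span_exps U :: 'k mpoly set) (poly_ring n)"
    and D: "stanley_decomposition n (ideal_module (poly_ring n) (span_exps U)) (std_grading (span_exps U)) D"
  obtains a where "(\<Union>i<length D. exp_cell (a i) (snd (D ! i))) = U"
    and "disjoint_family_on (\<lambda>i. exp_cell (a i) (snd (D ! i))) {..<length D}"
proof -
  let ?M = "ideal_module (poly_ring n) (span_exps U :: 'k mpoly set)"
  have "\<exists>a c. fst (D ! i) = Poly_Mapping.single a c \<and> c \<noteq> 0" if "i < length D" for i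
  proof -
    define m Z where "m = fst (D ! i)" and "Z = snd (D ! i)"
    have "(m, Z) \<in> set D" using that by (simp add: m_def Z_def)
    then obtain b where b: "m \<in> std_grading (span_exps U) b"
      and free: "\<forall>u\<in>polys_in Z. u * m = 0 \<longrightarrow> u = 0"
      using D unfolding stanley_decomposition_def by fastforce
    \<comment> \<open>Freeness is applied to \<open>u = 1\<close>.\<close>
    have "m \<noteq> 0" using free polys_in_1[of Z] by force
    then obtain e where e: "e \<in> Poly_Mapping.keys m" by (metis all_not_in_conv keys_eq_empty)
    have "f = e" if "f \<in> Poly_Mapping.keys m" for f
      using e b that by (intro map_int_inj) (simp add: std_grading_def)
    then have "Poly_Mapping.lookup m f = 0" if "f \<noteq> e" for f
      using that by (auto simp: in_keys_iff)
    then have "m = Poly_Mapping.single e (Poly_Mapping.lookup m e)"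
      by (intro poly_mapping_eqI) (simp add: lookup_single when_def)
    then show ?thesis using e unfolding m_def[symmetric] in_keys_iff by blast
  qed
  then have "\<forall>i. \<exists>b. i < length D \<longrightarrow> fst (D ! i) = Poly_Mapping.single (fst b) (snd b) \<and> snd b \<noteq> 0"
    by simp
  then obtain b where b: "\<forall>i. i < length D \<longrightarrow>
      fst (D ! i) = Poly_Mapping.single (fst (b i)) (snd (b i)) \<and> snd (b i) \<noteq> 0"
    unfolding choice_iff by (rule exE)
  define a where "a i = fst (b i)" for i
  have "is_direct_sum ?M {..<length D} (\<lambda>i. stanley_space ?M (fst (D ! i)) (snd (D ! i)))"
    using D by (simp add: stanley_decomposition_def)
  also have "?this \<longleftrightarrow> is_direct_sum ?M {..<length D} (\<lambda>i. span_exps (exp_cell (a i) (snd (D ! i))))"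
    by (rule is_direct_sum_cong) (simp add: b a_def stanley_space_monomial)
  finally show ?thesis
    using that unfolding direct_sum_span_iff[OF I] by blast
qed

section \<open>Existence of a Stanley decomposition\<close>

lemma stanley_decomposition_of_partition:
  fixes A :: "((nat \<Rightarrow>\<^sub>0 nat) \<times> nat set) list"
  assumes I: "ideal (span_exps U :: 'k::field mpoly set) (poly_ring n)"
    and Z: "\<And>a Z. (a, Z) \<in> set A \<Longrightarrow> Z \<subseteq> {1..n}"
    and cover: "(\<Union>i<length A. exp_cell (fst (A ! i)) (snd (A ! i))) = U"
    and disj: "disjoint_family_on (\<lambda>i. exp_cell (fst (A ! i)) (snd (A ! i))) {..<length A}"
  shows "stanley_decomposition n (ideal_module (poly_ring n) (span_exps U :: 'k mpoly set))
    (std_grading (span_exps U)) (map (\<lambda>(a, Z). (Poly_Mapping.single a 1, Z)) A)"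
proof -
  let ?M = "ideal_module (poly_ring n) (span_exps U :: 'k mpoly set)"
  let ?D = "map (\<lambda>(a, Z). (Poly_Mapping.single a (1::'k), Z)) A"
  have sub: "U \<subseteq> exps_in {1..n}"
  proof
    fix e assume "e \<in> U"
    then have "Poly_Mapping.single e (1::'k) \<in> polys_in {1..n}"
      using ideal_poly_ringD(5)[OF I] span_exps_single by blast
    then show "e \<in> exps_in {1..n}" by (simp add: polys_in_def exps_in_def)
  qed
  have aU: "a \<in> U" if aZ: "(a, Z) \<in> set A" for a Z
  proof -
    obtain i where i: "i < length A" "A ! i = (a, Z)" using aZ by (auto simp: in_set_conv_nth)
    have "a \<in> exp_cell (fst (A ! i)) (snd (A ! i))" by (simp add: i(2) exp_cell_iff)
    then show ?thesis using i(1) unfolding cover[symmetric] by blast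
  qed
  have hom: "\<exists>b\<in>Zn n. Poly_Mapping.single a (1::'k) \<in> std_grading (span_exps U) b" if "a \<in> U" for a
  proof
    show "Poly_Mapping.map int a \<in> Zn n"
      using sub that by (auto simp: Zn_def keys_map_int exps_in_def)
    show "Poly_Mapping.single a (1::'k) \<in> std_grading (span_exps U) (Poly_Mapping.map int a)"
      using span_exps_single[OF that] by (simp add: std_grading_def)
  qed
  have free: "u = 0" if "u * Poly_Mapping.single a (1::'k) = 0" for u and a :: "nat \<Rightarrow>\<^sub>0 nat"
  proof -
    have "Poly_Mapping.single a (1::'k) \<noteq> 0" by (metis lookup_single_eq lookup_zero zero_neq_one)
    with that show ?thesis by simp
  qed
  have "is_direct_sum ?M {..<length A} (\<lambda>i. span_exps (exp_cell (fst (A ! i)) (snd (A ! i))))"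
    using cover disj by (simp add: direct_sum_span_iff[OF I])
  also have "?this \<longleftrightarrow> is_direct_sum ?M {..<length ?D} (\<lambda>i. stanley_space ?M (fst (?D ! i)) (snd (?D ! i)))"
    unfolding length_map by (rule is_direct_sum_cong) (simp add: stanley_space_monomial split_beta)
  finally have "is_direct_sum ?M {..<length ?D} (\<lambda>i. stanley_space ?M (fst (?D ! i)) (snd (?D ! i)))" .
  moreover have "p \<in> carrier ?M \<and> (\<exists>b\<in>Zn n. p \<in> std_grading (span_exps U) b) \<and> Z \<subseteq> {1..n} \<and>
      (\<forall>u\<in>polys_in Z. u \<odot>\<^bsub>?M\<^esub> p = \<zero>\<^bsub>?M\<^esub> \<longrightarrow> u = 0)" if "(p, Z) \<in> set ?D" for p Z
  proof -
    from that obtain a where a: "p = Poly_Mapping.single a 1" "(a, Z) \<in> set A" by auto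
    note aU = aU[OF a(2)]
    show ?thesis unfolding a(1)
    proof (intro conjI ballI impI)
      show "Poly_Mapping.single a 1 \<in> carrier ?M" using span_exps_single[OF aU] by simp
      fix u assume "u \<odot>\<^bsub>?M\<^esub> Poly_Mapping.single a 1 = \<zero>\<^bsub>?M\<^esub>"
      then have "u * Poly_Mapping.single a 1 = 0" by simp
      then show "u = 0" by (rule free)
    qed (use hom[OF aU] assms(2)[OF a(2)] in blast)+
  qed
  ultimately show ?thesis unfolding stanley_decomposition_def by blast
qed

text \<open>Capping all coordinates at \<open>t\<close> maps \<open>U\<close> to its part inside the
  box of side \<open>t\<close>. The fibre over \<open>a\<close> is the cell that is free in exactly
  the coordinates where \<open>a\<close> attains \<open>t\<close>, and the box has finitely many
  points.\<close>

lemma box_partition: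
  assumes U: "U \<subseteq> exps_in {1..n}"
    and up: "\<And>e f. e \<in> U \<Longrightarrow> f \<in> exps_in {1..n} \<Longrightarrow> e + f \<in> U"
    and cap: "\<And>e. e \<in> U \<Longrightarrow> Poly_Mapping.map (min t) e \<in> U"
  obtains A :: "((nat \<Rightarrow>\<^sub>0 nat) \<times> nat set) list"
  where "\<And>a Z. (a, Z) \<in> set A \<Longrightarrow> Z \<subseteq> {1..n}"
    and "(\<Union>i<length A. exp_cell (fst (A ! i)) (snd (A ! i))) = U"
    and "disjoint_family_on (\<lambda>i. exp_cell (fst (A ! i)) (snd (A ! i))) {..<length A}"
proof -
  define B where "B = {a \<in> U. \<forall>j. Poly_Mapping.lookup a j \<le> t}"
  define Z where "Z a = {j \<in> {1..n}. Poly_Mapping.lookup a j = t}" for a :: "nat \<Rightarrow>\<^sub>0 nat"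
  have lookup_cap: "Poly_Mapping.lookup (Poly_Mapping.map (min t) e) j = min t (Poly_Mapping.lookup e j)" for e j
    by (simp add: map.rep_eq when_def)
  have zero: "Poly_Mapping.lookup e j = 0" if "e \<in> U" "j \<notin> {1..n}" for e j
    using U that unfolding exps_in_def in_keys_iff[symmetric] by (metis in_keys_iff mem_Collect_eq subsetD)
  have "finite B"
  proof (rule finite_imageD)
    have "Poly_Mapping.lookup ` B \<subseteq> {f. \<forall>x. (x \<in> {1..n} \<longrightarrow> f x \<in> {0..t}) \<and> (x \<notin> {1..n} \<longrightarrow> f x = 0)}"
      using zero by (auto simp: B_def)
    then show "finite (Poly_Mapping.lookup ` B)"
      by (rule finite_subset) (intro finite_set_of_finite_funs finite_atLeastAtMost)
    show "inj_on Poly_Mapping.lookup B"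
      by (intro inj_onI poly_mapping_eqI) simp
  qed
  then obtain as where as: "set as = B" "distinct as" using finite_distinct_list by blast
  define A where "A = map (\<lambda>a. (a, Z a)) as"
  have A_nth: "fst (A ! i) = as ! i" "snd (A ! i) = Z (as ! i)" if "i < length A" for i
    using that by (simp_all add: A_def)
  \<comment> \<open>Capping recovers the corner from any point of its cell; hence cells with
    different corners are disjoint.\<close>
  have cell_cap: "Poly_Mapping.map (min t) e = a" if "a \<in> B" "e \<in> exp_cell a (Z a)" for a e
  proof (rule poly_mapping_eqI)
    fix j
    have "Poly_Mapping.lookup a j \<le> t" using that(1) by (simp add: B_def)
    with that(2) show "Poly_Mapping.lookup (Poly_Mapping.map (min t) e) j = Poly_Mapping.lookup a j"
      unfolding lookup_cap exp_cell_iff Z_def mem_Collect_eq by (metis min.absorb1 min.absorb2)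
  qed
  show ?thesis
  proof (rule that[of A])
    show "Z \<subseteq> {1..n}" if "(a, Z) \<in> set A" for a Z
      using that by (auto simp: A_def Z_def)
    have "(\<Union>i<length A. exp_cell (fst (A ! i)) (snd (A ! i))) = (\<Union>a\<in>B. exp_cell a (Z a))"
      unfolding as(1)[symmetric] set_conv_nth by (auto simp: A_def)
    also have "\<dots> = U"
    proof (intro equalityI subsetI)
      fix e assume "e \<in> (\<Union>a\<in>B. exp_cell a (Z a))"
      then obtain a f where "a \<in> B" "e = a + f" "f \<in> exps_in (Z a)"
        by (auto simp: exp_cell_def)
      moreover from this have "a \<in> U" "f \<in> exps_in {1..n}"
        by (auto simp: exps_in_def B_def Z_def)
      ultimately show "e \<in> U" using up by simp
    next
      fix e assume e: "e \<in> U"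
      let ?a = "Poly_Mapping.map (min t) e"
      have "?a \<in> B" using cap[OF e] by (simp add: B_def lookup_cap)
      moreover have "e \<in> exp_cell ?a (Z ?a)"
        unfolding exp_cell_iff lookup_cap Z_def mem_Collect_eq using zero[OF e] by (auto simp: min_def)
      ultimately show "e \<in> (\<Union>a\<in>B. exp_cell a (Z a))" by blast
    qed
    finally show "(\<Union>i<length A. exp_cell (fst (A ! i)) (snd (A ! i))) = U" .
    show "disjoint_family_on (\<lambda>i. exp_cell (fst (A ! i)) (snd (A ! i))) {..<length A}"
      unfolding disjoint_family_on_def
    proof (intro ballI impI)
      fix i j assume ij: "i \<in> {..<length A}" "j \<in> {..<length A}" "i \<noteq> j"
      then have "i < length as" "j < length as" by (simp_all add: A_def)
      then have "as ! i \<noteq> as ! j" "as ! i \<in> B" "as ! j \<in> B"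
        using ij(3) as by (auto simp: nth_eq_iff_index_eq)
      then have "exp_cell (as ! i) (Z (as ! i)) \<inter> exp_cell (as ! j) (Z (as ! j)) = {}"
        using cell_cap by (metis disjoint_iff)
      then show "exp_cell (fst (A ! i)) (snd (A ! i)) \<inter> exp_cell (fst (A ! j)) (snd (A ! j)) = {}"
        using ij(1,2) by (simp add: A_nth)
    qed
  qed
qed

lemma walk_le_1:
  assumes "l \<le> n"
  shows "Poly_Mapping.lookup (walk n a l) i \<le> 1"
proof -
  \<comment> \<open>Fewer than \<open>n\<close> steps apart, two positions never give the same
    vertex.\<close>
  have inj: "j = j'" if "j < n" "j' < n" "(a + j) mod n = (a + j') mod n" for j j'
    using that cong_add_lcancel_nat[of a j j' n] by (simp add: cong_def)
  let ?S = "{j. j < l \<and> (a + j) mod n + 1 = i}"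
  have "\<forall>x\<in>?S. \<forall>y\<in>?S. x = y"
    by (intro ballI, rule inj) (use assms in auto)
  moreover have "finite ?S" by simp
  ultimately have "card ?S \<le> Suc 0" using card_le_Suc0_iff_eq by blast
  then show ?thesis by (simp add: lookup_walk)
qed

lemma power_exps_ge:
  assumes "g \<in> power_exps n m t" "f \<in> exps_in {1..n}"
    and le: "\<And>j. Poly_Mapping.lookup g j \<le> Poly_Mapping.lookup f j"
  shows "f \<in> power_exps n m t"
proof -
  have "f = g + (f - g)"
    using le by (intro poly_mapping_eqI) (simp add: lookup_add lookup_minus)
  moreover have "Poly_Mapping.keys (f - g) \<subseteq> Poly_Mapping.keys f"
    by (rule subsetI) (simp add: in_keys_iff lookup_minus)
  then have "f - g \<in> exps_in {1..n}"
    using assms(2) unfolding exps_in_def by blast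
  ultimately show ?thesis using power_exps_up[OF assms(1)] by metis
qed

text \<open>For \<open>m \<le> n\<close> the generators are squarefree, so a product of
  \<open>t\<close> of them has no exponent above \<open>t\<close>; \<open>g\<close> is such a
  product dividing the monomial of \<open>e\<close>.\<close>

lemma power_exps_bounded_below:
  assumes "e \<in> power_exps n m t" "m \<le> n"
  obtains g where "g \<in> power_exps n m t" "\<And>j. Poly_Mapping.lookup g j \<le> min t (Poly_Mapping.lookup e j)"
  using assms(1)
proof (induction t arbitrary: e thesis)
  case 0
  show ?case by (rule 0(1)[of 0]) (simp_all add: exps_in_def)
next
  case (Suc t)
  from Suc.prems(2) obtain e' i where e: "e = e' + walk n i m" "e' \<in> power_exps n m t" by auto
  from Suc.IH[OF _ e(2)] obtain g where g: "g \<in> power_exps n m t"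
    "\<And>j. Poly_Mapping.lookup g j \<le> min t (Poly_Mapping.lookup e' j)" by blast
  show ?case
  proof (rule Suc.prems(1)[of "g + walk n i m"])
    show "g + walk n i m \<in> power_exps n m (Suc t)" using g(1) by auto
    fix j
    show "Poly_Mapping.lookup (g + walk n i m) j \<le> min (Suc t) (Poly_Mapping.lookup e j)"
      using g(2)[of j] walk_le_1[OF assms(2), of i j] by (simp add: e(1) lookup_add)
  qed
qed

lemma power_exps_cap:
  assumes e: "e \<in> power_exps n m t" and "m \<le> n" "n > 0"
  shows "Poly_Mapping.map (min t) e \<in> power_exps n m t"
proof -
  obtain g where g: "g \<in> power_exps n m t" "\<And>j. Poly_Mapping.lookup g j \<le> min t (Poly_Mapping.lookup e j)"
    using power_exps_bounded_below[OF e assms(2)] by blast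
  show ?thesis
  proof (rule power_exps_ge[OF g(1)])
    show "Poly_Mapping.map (min t) e \<in> exps_in {1..n}"
    proof -
      have "Poly_Mapping.keys (Poly_Mapping.map (min t) e) \<subseteq> Poly_Mapping.keys e"
        by (rule subsetI) (simp add: in_keys_iff map.rep_eq when_def split: if_splits)
      moreover have "e \<in> exps_in {1..n}" using power_exps_subset[OF assms(3)] e by blast
      ultimately show ?thesis unfolding exps_in_def by blast
    qed
    show "Poly_Mapping.lookup g j \<le> Poly_Mapping.lookup (Poly_Mapping.map (min t) e) j" for j
      using g(2)[of j] by (simp add: map.rep_eq when_def)
  qed
qed

text \<open>\<open>sdepth\<close> is a \<open>Max\<close>, which can be bounded only if the set of
  values is nonempty.\<close>

lemma stanley_decomposition_exists:
  assumes "n > 0" "m \<le> n"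
  shows "\<exists>D. stanley_decomposition n (ideal_module (poly_ring n) (span_exps (power_exps n m t) :: 'k::field mpoly set))
    (std_grading (span_exps (power_exps n m t))) D"
proof -
  obtain A :: "((nat \<Rightarrow>\<^sub>0 nat) \<times> nat set) list" where A: "\<And>a Z. (a, Z) \<in> set A \<Longrightarrow> Z \<subseteq> {1..n}"
    "(\<Union>i<length A. exp_cell (fst (A ! i)) (snd (A ! i))) = power_exps n m t"
    "disjoint_family_on (\<lambda>i. exp_cell (fst (A ! i)) (snd (A ! i))) {..<length A}"
    using box_partition[OF power_exps_subset[OF assms(1)] power_exps_up power_exps_cap[OF _ assms(2,1)]]
    by blast
  show ?thesis
    by (rule exI, rule stanley_decomposition_of_partition[OF ideal_span_power_exps[OF assms(1)] _ A(2,3)])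
      (rule A(1))
qed

section \<open>The counting bound\<close>

definition ind_exp :: "nat set \<Rightarrow> (nat \<Rightarrow>\<^sub>0 nat)" where
  "ind_exp S = (\<Sum>s\<in>S. Poly_Mapping.single s 1)"

definition transversals :: "nat \<Rightarrow> nat \<Rightarrow> nat set set" where
  "transversals n d = {S. S \<subseteq> {1..n} \<and> (\<forall>r<d. \<exists>!s. s \<in> S \<and> s mod d = r)}"

lemma lookup_ind_exp: "finite S \<Longrightarrow> Poly_Mapping.lookup (ind_exp S) j = of_bool (j \<in> S)"
  by (simp add: ind_exp_def lookup_sum lookup_single when_def of_bool_def)

lemma transversal_bij:
  assumes "S \<in> transversals n d" "d > 0"
  shows "bij_betw (\<lambda>s. s mod d) S {..<d}"
proof -
  have *: "\<exists>!s. s \<in> S \<and> s mod d = r" if "r < d" for r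
    using assms(1) that by (simp add: transversals_def)
  have "inj_on (\<lambda>s. s mod d) S"
  proof (rule inj_onI)
    fix x y assume "x \<in> S" "y \<in> S" "x mod d = y mod d"
    then show "x = y" using *[of "x mod d"] assms(2) by auto
  qed
  moreover have "(\<lambda>s. s mod d) ` S = {..<d}"
  proof
    show "{..<d} \<subseteq> (\<lambda>s. s mod d) ` S"
    proof
      fix r assume "r \<in> {..<d}"
      then have "\<exists>s. s \<in> S \<and> s mod d = r" using *[of r] by auto
      then show "r \<in> (\<lambda>s. s mod d) ` S" by blast
    qed
  qed (use assms(2) in auto)
  ultimately show ?thesis by (simp add: bij_betw_def)
qed

lemma card_transversal: "S \<in> transversals n d \<Longrightarrow> d > 0 \<Longrightarrow> card S = d"
  using bij_betw_same_card[OF transversal_bij] by simp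

lemma finite_transversals: "finite (transversals n d)"
  by (rule finite_subset[of _ "Pow {1..n}"]) (auto simp: transversals_def)

lemma transversals_nonempty:
  assumes "0 < d" "d \<le> n"
  shows "{1..d} \<in> transversals n d"
proof -
  have "\<exists>!s. s \<in> {1..d} \<and> s mod d = r" if "r < d" for r
  \<comment> \<open>Vertices are numbered from 1, so class 0 is represented by \<open>d\<close> and
    any other class by \<open>r\<close> itself.\<close>
  proof (cases "r = 0")
    case True
    show ?thesis
    proof (rule ex1I[of _ d])
      show "s = d" if "s \<in> {1..d} \<and> s mod d = r" for s
        using that True by (metis atLeastAtMost_iff le_neq_implies_less mod_less not_one_le_zero)
    qed (use assms True in auto)
  next
    case False
    show ?thesis
    proof (rule ex1I[of _ r])
      show "s = r" if "s \<in> {1..d} \<and> s mod d = r" for s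
        using that False by (metis atLeastAtMost_iff le_neq_implies_less mod_less mod_self)
    qed (use that False in auto)
  qed
  then show ?thesis using assms by (auto simp: transversals_def)
qed

section \<open>Exchanging an element of a transversal within its class\<close>

definition class_rep :: "nat \<Rightarrow> nat set \<Rightarrow> nat \<Rightarrow> nat" where
  "class_rep d S z = (THE s. s \<in> S \<and> s mod d = z mod d)"

lemma class_rep:
  assumes "S \<in> transversals n d" "d > 0"
  shows "class_rep d S z \<in> S" "class_rep d S z mod d = z mod d"
    "s \<in> S \<Longrightarrow> s mod d = z mod d \<Longrightarrow> s = class_rep d S z"
proof -
  have *: "\<exists>!s. s \<in> S \<and> s mod d = z mod d"
    using assms by (simp add: transversals_def)
  show "class_rep d S z \<in> S" "class_rep d S z mod d = z mod d"
    using theI'[OF *] by (simp_all add: class_rep_def)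
  then show "s \<in> S \<Longrightarrow> s mod d = z mod d \<Longrightarrow> s = class_rep d S z"
    using * by blast
qed

text \<open>For \<open>z\<close> outside \<open>S\<close>, the set \<open>insert z S\<close>
  contains exactly two transversals. A pair records one of them together with the left-over vertex,
  and the map passes to the other; on such pairs it is an involution that preserves the
  union.\<close>

definition swap_class :: "nat \<Rightarrow> nat set \<times> nat \<Rightarrow> nat set \<times> nat" where
  "swap_class d = (\<lambda>(S, z). (insert z (S - {class_rep d S z}), class_rep d S z))"

lemma swap_class:
  assumes S: "S \<in> transversals n d" and d: "d > 0" and z: "z \<in> {1..n} - S"
    and sw: "swap_class d (S, z) = (S', z')"
  shows "S' \<in> transversals n d" "z' \<in> {1..n} - S'" "swap_class d (S', z') = (S, z)"
    "insert z S = insert z' S'" "z \<in> S'"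
proof -
  note rep = class_rep[OF S d, where z = z]
  have eqs: "S' = insert z (S - {z'})" "z' = class_rep d S z" using sw by (auto simp: swap_class_def)
  have zz: "z' \<noteq> z" using rep(1) z eqs(2) by auto
  have "\<exists>!s. s \<in> S' \<and> s mod d = r" if r: "r < d" for r
  proof (cases "r = z mod d")
    case True
    show ?thesis
    proof (rule ex1I[of _ z])
      show "z \<in> S' \<and> z mod d = r" by (simp add: eqs(1) True)
      show "s = z" if "s \<in> S' \<and> s mod d = r" for s
        using that rep(3)[of s] True unfolding eqs by blast
    qed
  next
    case False
    have "\<exists>!s. s \<in> S \<and> s mod d = r" using S r by (simp add: transversals_def)
    moreover have "s \<in> S' \<and> s mod d = r \<longleftrightarrow> s \<in> S \<and> s mod d = r" for s
      using False rep(2) unfolding eqs by auto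
    ultimately show ?thesis by simp
  qed
  moreover have "S' \<subseteq> {1..n}" using S z by (auto simp: eqs(1) transversals_def)
  ultimately show S': "S' \<in> transversals n d" by (simp add: transversals_def)
  show "z' \<in> {1..n} - S'" using rep(1) S zz by (auto simp: eqs transversals_def)
  show "insert z S = insert z' S'" using rep(1) by (auto simp: eqs)
  show "z \<in> S'" by (simp add: eqs(1))
  then have "z = class_rep d S' z'" using rep(2) by (intro class_rep(3)[OF S' d]) (simp_all add: eqs(2))
  then have "swap_class d (S', z') = (insert z' (S' - {z}), z)" by (simp add: swap_class_def)
  also have "insert z' (S' - {z}) = S" using rep(1) z zz by (auto simp: eqs)
  finally show "swap_class d (S', z') = (S, z)" .
qed

lemma exp_cell_bound:
  fixes a :: "nat \<Rightarrow> (nat \<Rightarrow>\<^sub>0 nat)" and Z :: "nat \<Rightarrow> nat set"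
  assumes d: "0 < d" "d \<le> n"
    and cover: "(\<Union>i<l. exp_cell (a i) (Z i)) = U"
    and disj: "disjoint_family_on (\<lambda>i. exp_cell (a i) (Z i)) {..<l}"
    and Z: "\<And>i. i < l \<Longrightarrow> Z i \<subseteq> {1..n}" "\<And>i. i < l \<Longrightarrow> k \<le> card (Z i)"
    and mem: "\<And>S. S \<in> transversals n d \<Longrightarrow> w + ind_exp S \<in> U"
    and nonmem: "\<And>S T. S \<in> transversals n d \<Longrightarrow> T \<subset> S \<Longrightarrow> w + ind_exp T \<notin> U"
  shows "2 * k \<le> n + d"
proof -
  let ?T = "transversals n d"
  have fin: "finite S" if "S \<in> ?T" for S
    using that finite_subset by (auto simp: transversals_def)
  have "\<forall>S. \<exists>i. S \<in> ?T \<longrightarrow> i < l \<and> w + ind_exp S \<in> exp_cell (a i) (Z i)"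
    using mem unfolding cover[symmetric] by blast
  then obtain c where c: "\<forall>S. S \<in> ?T \<longrightarrow> c S < l \<and> w + ind_exp S \<in> exp_cell (a (c S)) (Z (c S))"
    unfolding choice_iff by (rule exE)
  \<comment> \<open>The componentwise minimum of the exponents for \<open>S\<close> and
    \<open>S'\<close> is the one for \<open>S \<inter> S'\<close>. If both lie in one cell, so does
    the minimum, which \<open>nonmem\<close> forbids when \<open>S \<inter> S'\<close> is a proper
    subset of \<open>S\<close>.\<close>
  have sub: "S \<subseteq> S'" if S: "S \<in> ?T" "S' \<in> ?T" and eq: "c S = c S'" for S S'
  proof (rule ccontr)
    assume "\<not> S \<subseteq> S'"
    then have "w + ind_exp (S \<inter> S') \<notin> U" by (intro nonmem[OF S(1)]) auto
    moreover have "w + ind_exp (S \<inter> S') \<in> exp_cell (a (c S)) (Z (c S))"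
      unfolding exp_cell_iff
    proof (intro allI)
      fix j
      have 1: "w + ind_exp S \<in> exp_cell (a (c S)) (Z (c S))" using c S(1) by blast
      have 2: "w + ind_exp S' \<in> exp_cell (a (c S)) (Z (c S))" using c S(2) unfolding eq by blast
      show "Poly_Mapping.lookup (a (c S)) j \<le> Poly_Mapping.lookup (w + ind_exp (S \<inter> S')) j \<and>
        (j \<notin> Z (c S) \<longrightarrow> Poly_Mapping.lookup (w + ind_exp (S \<inter> S')) j = Poly_Mapping.lookup (a (c S)) j)"
        using 1[unfolded exp_cell_iff, rule_format, of j] 2[unfolded exp_cell_iff, rule_format, of j]
          fin[OF S(1)] fin[OF S(2)]
        by (cases "j \<in> S"; cases "j \<in> S'") (simp_all add: lookup_add lookup_ind_exp)
    qed
    ultimately show False using c S(1) cover by blast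
  qed
  \<comment> \<open>\<open>P\<close> consists of all pairs of a transversal and a vertex outside it,
    \<open>G\<close> of those where adding the vertex stays in the cell of the transversal by a free
    direction.\<close>
  define P where "P = Sigma ?T (\<lambda>S. {1..n} - S)"
  define G where "G = Sigma ?T (\<lambda>S. Z (c S) - S)"
  have finP: "finite P" unfolding P_def by (intro finite_SigmaI finite_transversals) simp
  have GP: "G \<subseteq> P" unfolding P_def G_def using c Z(1) by blast
  have "swap_class d x \<in> P - G" if x: "x \<in> G" for x
  proof -
    obtain S z S' z' where eqs: "x = (S, z)" "swap_class d x = (S', z')" by (metis surj_pair)
    have S: "S \<in> ?T" "z \<in> Z (c S)" "z \<in> {1..n} - S" using x GP by (auto simp: eqs G_def P_def)
    note sw = swap_class[OF S(1) d(1) S(3) eqs(2)[unfolded eqs(1)]]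
    have add: "w + ind_exp (insert y R) \<in> exp_cell (a (c R)) (Z (c R))"
      if R: "R \<in> ?T" "y \<in> Z (c R)" for R y
      unfolding exp_cell_iff
    proof (intro allI)
      fix j
      have 1: "w + ind_exp R \<in> exp_cell (a (c R)) (Z (c R))" using c R(1) by blast
      show "Poly_Mapping.lookup (a (c R)) j \<le> Poly_Mapping.lookup (w + ind_exp (insert y R)) j \<and>
        (j \<notin> Z (c R) \<longrightarrow> Poly_Mapping.lookup (w + ind_exp (insert y R)) j = Poly_Mapping.lookup (a (c R)) j)"
        using 1[unfolded exp_cell_iff, rule_format, of j] fin[OF R(1)] R(2)
        by (cases "j \<in> R"; cases "j = y") (simp_all add: lookup_add lookup_ind_exp)
    qed
    \<comment> \<open>If both pairs were in \<open>G\<close>, their common union would put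
      \<open>w + ind_exp (insert z S)\<close> into both cells. The cells would then coincide and
      force \<open>S' \<subseteq> S\<close>, although \<open>z\<close> lies only in
      \<open>S'\<close>.\<close>
    have "(S', z') \<notin> G"
    proof
      assume G: "(S', z') \<in> G"
      then have z': "z' \<in> Z (c S')" by (simp add: G_def)
      have "c S = c S'"
      proof (rule ccontr)
        assume "c S \<noteq> c S'"
        then have "exp_cell (a (c S)) (Z (c S)) \<inter> exp_cell (a (c S')) (Z (c S')) = {}"
          using disj c S(1) sw(1) by (auto simp: disjoint_family_on_def)
        then show False using add[OF S(1,2)] add[OF sw(1) z'] unfolding sw(4) by blast
      qed
      then have "S' \<subseteq> S" by (intro sub sw(1) S(1)) simp
      then show False using sw(5) S(3) by blast
    qed
    then show ?thesis using sw(1,2) unfolding eqs(2) by (simp add: P_def)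
  qed
  then have "swap_class d ` G \<subseteq> P - G" by blast
  moreover have "inj_on (swap_class d) G"
  proof (rule inj_on_inverseI[of _ "swap_class d"])
    fix x assume "x \<in> G"
    then have "fst x \<in> ?T" "snd x \<in> {1..n} - fst x" using GP by (auto simp: P_def)
    from swap_class(3)[OF this(1) d(1) this(2)]
    show "swap_class d (swap_class d x) = x" by (metis prod.collapse)
  qed
  \<comment> \<open>The swap embeds \<open>G\<close> into its complement in \<open>P\<close>, so
    \<open>G\<close> is at most half of \<open>P\<close>.\<close>
  ultimately have "card G \<le> card (P - G)" using finP by (metis card_image card_mono finite_Diff)
  then have "2 * card G \<le> card P"
    using GP finP by (simp add: card_Diff_subset finite_subset)
  moreover have "card P = card ?T * (n - d)"
  proof -
    have "card ({1..n} - S) = n - d" if "S \<in> ?T" for S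
      using that fin[OF that] card_transversal[OF that d(1)] by (subst card_Diff_subset) (auto simp: transversals_def)
    then show ?thesis unfolding P_def by (subst card_SigmaI) (auto simp: finite_transversals)
  qed
  moreover have "card ?T * (k - d) \<le> card G"
  proof -
    have "k - d \<le> card (Z (c S) - S)" if "S \<in> ?T" for S
    proof -
      have "c S < l" using c that by blast
      then have "k - d \<le> card (Z (c S)) - card S"
        using Z(2)[of "c S"] card_transversal[OF that d(1)] by simp
      also have "\<dots> \<le> card (Z (c S) - S)" by (rule diff_card_le_card_Diff[OF fin[OF that]])
      finally show ?thesis .
    qed
    then have "(\<Sum>S\<in>?T. k - d) \<le> (\<Sum>S\<in>?T. card (Z (c S) - S))" by (intro sum_mono)
    also have "\<dots> = card G"
      unfolding G_def
    proof (rule card_SigmaI[symmetric])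
      show "\<forall>S\<in>?T. finite (Z (c S) - S)"
        using c Z(1) by (meson finite_Diff finite_atLeastAtMost finite_subset)
    qed (rule finite_transversals)
    finally show ?thesis by simp
  qed
  moreover have "card ?T > 0"
    using transversals_nonempty[OF d] finite_transversals card_gt_0_iff by blast
  ultimately have "card ?T * (2 * (k - d)) \<le> card ?T * (n - d)" by linarith
  then have "2 * (k - d) \<le> n - d" using \<open>card ?T > 0\<close> by simp
  \<comment> \<open>Subtraction is truncated; for \<open>k < d\<close> the bound comes from
    \<open>d \<le> n\<close> alone.\<close>
  then show ?thesis using d(2) by linarith
qed

section \<open>Walks around the cycle\<close>

lemma walk_Suc: "walk n a (Suc l) = walk n a l + Poly_Mapping.single ((a + l) mod n + 1) 1"
  by (simp add: walk_def)

text \<open>A walk of \<open>m * L\<close> steps is cut into \<open>L\<close> consecutive blocks,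
  each of them a generator.\<close>

lemma power_exps_walk: "n > 0 \<Longrightarrow> walk n a (m * L) \<in> power_exps n m L"
proof (induction L)
  case 0
  then show ?case by (simp add: walk_def exps_in_def)
next
  case (Suc L)
  have "walk n a (m * Suc L) = walk n a (m * L) + walk n (a + m * L) m"
    using walk_add[of n a "m * L" m] by (simp add: add.commute)
  with Suc show ?case by auto
qed

lemma power_exps_add:
  "e \<in> power_exps n m s \<Longrightarrow> f \<in> power_exps n m t \<Longrightarrow> e + f \<in> power_exps n m (s + t)"
proof (induction t arbitrary: f)
  case 0
  then show ?case by (simp add: power_exps_up)
next
  case (Suc t)
  then obtain f' i where f: "f = f' + walk n i m" "f' \<in> power_exps n m t" by auto
  have "e + f = (e + f') + walk n i m" by (simp add: f(1) add_ac)
  with Suc.IH[OF Suc.prems(1) f(2)] show ?case by auto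
qed

text \<open>Full rounds visit all vertices equally often. Moving the start of one round by a step
  drops a vertex at the front and adds the same vertex at the end.\<close>

lemma walk_full: "walk n a (A * n) = walk n 0 (A * n)"
proof (induction A)
  case (Suc A)
  have 1: "walk n a n = walk n 0 n" for a
  proof (induction a)
    case (Suc a)
    have "walk n a 1 + walk n (Suc a) n = walk n a n + walk n (a + n) 1"
      using walk_add[of n a 1 n] walk_add[of n a n 1] by (simp add: add.commute)
    also have "walk n (a + n) 1 = walk n a 1" by (simp add: walk_def)
    finally have "walk n a 1 + walk n (Suc a) n = walk n a 1 + walk n 0 n"
      using Suc by (simp add: add.commute)
    then show ?case by (rule add_left_imp_eq)
  qed simp
  have "walk n b (Suc A * n) = walk n b (A * n) + walk n 0 n" for b
    using walk_add[of n b "A * n" n] 1[of "b + A * n"] by (simp add: add.commute)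
  then show ?case using Suc by simp
qed (simp add: walk_def)

definition exp_degree :: "nat \<Rightarrow> (nat \<Rightarrow>\<^sub>0 nat) \<Rightarrow> nat" where
  "exp_degree n e = (\<Sum>j\<in>{1..n}. Poly_Mapping.lookup e j)"

lemma exp_degree_add: "exp_degree n (e + f) = exp_degree n e + exp_degree n f"
  by (simp add: exp_degree_def lookup_add sum.distrib)

lemma exp_degree_single: "i \<in> {1..n} \<Longrightarrow> exp_degree n (Poly_Mapping.single i c) = c"
  by (simp add: exp_degree_def lookup_single when_def)

lemma exp_degree_walk: "n > 0 \<Longrightarrow> exp_degree n (walk n a l) = l"
proof (induction l)
  case (Suc l)
  have "(a + l) mod n + 1 \<in> {1..n}" using Suc.prems by (simp add: Suc_le_eq)
  then show ?case using Suc by (simp only: walk_Suc exp_degree_add exp_degree_single)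
qed (simp add: walk_def exp_degree_def)

lemma exp_degree_ind_exp: "S \<subseteq> {1..n} \<Longrightarrow> exp_degree n (ind_exp S) = card S"
proof -
  assume S: "S \<subseteq> {1..n}"
  then have fin: "finite S" by (rule finite_subset) simp
  have "exp_degree n (ind_exp S) = (\<Sum>j\<in>{1..n}. if j \<in> S then 1 else 0)"
    unfolding exp_degree_def by (intro sum.cong) (simp_all add: lookup_ind_exp[OF fin])
  also have "\<dots> = card ({1..n} \<inter> S)" by (subst sum.If_cases) simp_all
  also have "{1..n} \<inter> S = S" using S by blast
  finally show ?thesis .
qed

lemma exp_degree_power_exps: "n > 0 \<Longrightarrow> e \<in> power_exps n m t \<Longrightarrow> m * t \<le> exp_degree n e"
  by (induction t arbitrary: e) (auto simp: exp_degree_add exp_degree_walk)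

text \<open>Modulo \<open>n\<close>, the multiples of \<open>m\<close> are exactly the multiples of
  \<open>d = gcd n m\<close>. They form a cyclic group of order \<open>n div d\<close>, so a
  suitable \<open>L\<close> exists among the first \<open>n div d\<close> positive integers.\<close>

lemma steps_to_congruent:
  fixes n m a c :: nat
  assumes n: "n > 0" and cong: "a mod gcd n m = c mod gcd n m"
  obtains L where "1 \<le> L" "L \<le> n div gcd n m" "(a + m * L) mod n = c mod n"
proof -
  define d q where "d = gcd n m" and "q = n div d"
  have d: "d > 0" "n = d * q" using n by (simp_all add: d_def q_def)
  have q: "q > 0" using n d by (cases q) auto
  obtain m' where m': "m = d * m'" unfolding d_def by (meson gcd_dvd2 dvdE)
  obtain x where x: "[int m * x = int d] (mod int n)"
    using cong_solve_int[of "int m" "int n"] by (auto simp: d_def gcd.commute)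
  have "int d dvd int c - int a"
    using cong unfolding d_def[symmetric]
    by (metis cong_def cong_iff_dvd_diff cong_sym zmod_int)
  then obtain u where u: "int c - int a = int d * u" by blast
  \<comment> \<open>\<open>L\<close> is the representative of \<open>x * u\<close> modulo
    \<open>q\<close> in \<open>{1..q}\<close>; the shift by one excludes the empty leg
    \<open>L = 0\<close>.\<close>
  define L where "L = nat ((x * u - 1) mod int q) + 1"
  have "(x * u - 1) mod int q < int q" "0 \<le> (x * u - 1) mod int q" using q by auto
  then have Lq: "1 \<le> L" "L \<le> q" and L: "int L = (x * u - 1) mod int q + 1"
    unfolding L_def by linarith+
  have "int q dvd (x * u - 1) - (x * u - 1) mod int q" by simp
  then have "int q dvd x * u - int L" unfolding L by (simp add: algebra_simps)
  \<comment> \<open>Multiplication by \<open>m = d * m'\<close> turns a multiple of \<open>q\<close>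
    into one of \<open>n = d * q\<close>.\<close>
  then have "int n dvd int m * (x * u - int L)"
    unfolding m' d(2) by (simp add: mult.assoc dvd_mult mult_dvd_mono)
  then have 1: "[int m * (x * u) = int m * int L] (mod int n)"
    by (simp add: cong_iff_dvd_diff right_diff_distrib)
  have 2: "[int m * x * u = int d * u] (mod int n)" by (rule cong_scalar_right[OF x])
  have "[int m * int L = int c - int a] (mod int n)"
    using cong_trans[OF cong_sym[OF 1]] 2 unfolding u by (simp add: mult.assoc)
  then have "[int a + int m * int L = int a + (int c - int a)] (mod int n)"
    by (rule cong_add[OF cong_refl])
  then have "[int (a + m * L) = int c] (mod int n)" by simp
  then have "[a + m * L = c] (mod n)" by (simp only: cong_int_iff)
  then have "(a + m * L) mod n = c mod n" by (simp only: cong_def)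
  then show ?thesis using that Lq by (simp add: q_def d_def)
qed

text \<open>
  The walk goes once through all classes modulo \<open>d\<close> in descending order.  Each leg is a
  concatenation of generators that starts at the element of \<open>S\<close> in one class and ends at the
  element of \<open>S\<close> in the next one, where the following leg starts.  So the elements of \<open>S\<close> are
  covered once more than the other vertices.
\<close>

lemma ind_exp_walk:
  assumes S: "S \<in> transversals n d" and d: "d = gcd n m" and m: "m > 0" and n: "n > 0"
  obtains A C where "C \<le> n" "m * C = A * n + d" "walk n 0 (A * n) + ind_exp S \<in> power_exps n m C"
proof -
  have d0: "d > 0" using n d by simp
  have dn: "d dvd n" using d by simp
  define q where "q = n div d"
  \<comment> \<open>\<open>r * (d - 1)\<close> is congruent to \<open>-r\<close> modulo
    \<open>d\<close>, so \<open>\<tau> r\<close> runs through the classes in descending order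
    without negative numbers.\<close>
  define \<tau> where "\<tau> r = class_rep d S (r * (d - 1))" for r
  have \<tau>: "\<tau> r \<in> S" "\<tau> r mod d = (r * (d - 1)) mod d" for r
    using class_rep[OF S d0] by (simp_all add: \<tau>_def)
  have Sn: "S \<subseteq> {1..n}" using S by (simp add: transversals_def)
  define b0 where "b0 = \<tau> 0 - 1"
  \<comment> \<open>After \<open>r\<close> legs, \<open>C\<close> generators are used and the walk
    has reached position \<open>b\<close> of \<open>\<tau> r\<close>. The plain walk stops just
    before \<open>b\<close>; the sum holds the \<open>r\<close> end points of legs, which are
    visited once more as starting points. This is why \<open>b + r = b0 + m * C\<close>.\<close>
  have "\<exists>C b. C \<le> r * q \<and> b0 \<le> b \<and> b + r = b0 + m * C \<and> b mod n + 1 = \<tau> r \<and>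
      walk n b0 (b - b0) + (\<Sum>i<r. Poly_Mapping.single (\<tau> (Suc i)) 1) \<in> power_exps n m C" for r
  proof (induction r)
    case 0
    have "\<tau> 0 \<in> {1..n}" using \<tau>(1) Sn by blast
    then have "b0 mod n + 1 = \<tau> 0" by (auto simp: b0_def)
    then show ?case
      by (intro exI[of _ 0] exI[of _ b0]) (simp add: walk_def exps_in_def)
  next
    case (Suc r)
    then obtain C b where C: "C \<le> r * q" "b0 \<le> b" "b + r = b0 + m * C" "b mod n + 1 = \<tau> r"
      "walk n b0 (b - b0) + (\<Sum>i<r. Poly_Mapping.single (\<tau> (Suc i)) 1) \<in> power_exps n m C" by blast
    \<comment> \<open>The vertex at position \<open>b\<close> is congruent to \<open>b + 1\<close>,
      and a leg of \<open>m * L\<close> steps ends at a vertex congruent to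
      \<open>b + m * L\<close>. The class wanted next is one below that of \<open>\<tau> r\<close>,
      which is the class of \<open>b\<close>, so a leg exists.\<close>
    have "b mod d = (b + 1 + (d - 1)) mod d" using d0 by simp
    also have "\<dots> = (\<tau> r + (d - 1)) mod d"
      using dn unfolding C(4)[symmetric] by (metis mod_add_cong mod_add_left_eq mod_mod_cancel)
    also have "\<dots> = (r * (d - 1) + (d - 1)) mod d" using \<tau>(2) by (metis mod_add_left_eq)
    also have "\<dots> = \<tau> (Suc r) mod d" using \<tau>(2)[of "Suc r"] by (simp add: add.commute)
    finally obtain L where L: "1 \<le> L" "L \<le> q" "(b + m * L) mod n = \<tau> (Suc r) mod n"
      using steps_to_congruent[OF n] unfolding q_def d by metis
    define b' where "b' = b + (m * L - 1)"
    have mL: "m * L \<ge> 1" using L(1) m by simp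
    have b': "b' + 1 = b + m * L" using mL by (simp add: b'_def)
    have "\<tau> (Suc r) \<in> {1..n}" using \<tau>(1) Sn by blast
    moreover have "(b' + 1) mod n = \<tau> (Suc r) mod n" using L(3) b' by simp
    \<comment> \<open>Residue 0 belongs to vertex \<open>n\<close>, which is treated
      separately.\<close>
    ultimately have "b' mod n + 1 = \<tau> (Suc r)"
      by (cases "\<tau> (Suc r) = n") (auto simp: mod_Suc split: if_splits)
    moreover have "walk n b0 (b' - b0) + (\<Sum>i<Suc r. Poly_Mapping.single (\<tau> (Suc i)) 1)
      \<in> power_exps n m (C + L)"
    proof -
      have "walk n b0 (b' - b0) = walk n b0 (b - b0) + walk n b (m * L - 1)"
        using walk_add[of n b0 "b - b0" "m * L - 1"] C(2) by (simp add: b'_def)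
      moreover have "walk n b (m * L) = walk n b (m * L - 1) + Poly_Mapping.single (\<tau> (Suc r)) 1"
        using walk_Suc[of n b "m * L - 1"] mL \<open>b' mod n + 1 = \<tau> (Suc r)\<close>
        by (simp add: b'_def)
      ultimately have "walk n b0 (b' - b0) + (\<Sum>i<Suc r. Poly_Mapping.single (\<tau> (Suc i)) 1) =
        (walk n b0 (b - b0) + (\<Sum>i<r. Poly_Mapping.single (\<tau> (Suc i)) 1)) + walk n b (m * L)"
        by (simp add: add_ac)
      then show ?thesis using power_exps_add[OF C(5) power_exps_walk[OF n]] by simp
    qed
    moreover have "C + L \<le> Suc r * q" using C(1) L(2) by simp
    moreover have "b' + Suc r = b0 + m * (C + L)" using b' C(3) by (simp add: distrib_left)
    moreover have "b0 \<le> b'" using C(2) by (simp add: b'_def)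
    ultimately show ?case by blast
  qed
  from this[of d] obtain C b where C: "C \<le> d * q" "b0 \<le> b" "b + d = b0 + m * C" "b mod n + 1 = \<tau> d"
      "walk n b0 (b - b0) + (\<Sum>i<d. Poly_Mapping.single (\<tau> (Suc i)) 1) \<in> power_exps n m C" by blast
  \<comment> \<open>After \<open>d\<close> legs the walk is back at its first vertex, so the plain
    part consists of \<open>A\<close> full rounds.\<close>
  have "\<tau> d = \<tau> 0" by (simp add: \<tau>_def class_rep_def)
  moreover have "\<tau> 0 \<in> {1..n}" using \<tau>(1) Sn by blast
  ultimately have "b mod n = b0 mod n" using C(4) by (auto simp: b0_def)
  then have "n dvd b - b0" using mod_eq_dvd_iff_nat[OF C(2)] by simp
  then obtain A where A: "b - b0 = A * n" by (metis dvdE mult.commute)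
  \<comment> \<open>As \<open>d - 1\<close> is coprime to \<open>d\<close>, the \<open>d\<close> end
    points lie in different classes and therefore exhaust \<open>S\<close>.\<close>
  have inj: "inj_on (\<lambda>i. \<tau> (Suc i)) {..<d}"
  proof (rule inj_onI)
    fix i j assume ij: "i \<in> {..<d}" "j \<in> {..<d}" "\<tau> (Suc i) = \<tau> (Suc j)"
    then have "[Suc i * (d - 1) = Suc j * (d - 1)] (mod d)"
      using \<tau>(2)[of "Suc i"] \<tau>(2)[of "Suc j"] by (simp add: cong_def)
    then have "[Suc i = Suc j] (mod d)"
      using cong_mult_rcancel_nat[of "d - 1" d "Suc i" "Suc j"] coprime_diff_one_left_nat[OF d0] by blast
    then have "[i = j] (mod d)" using cong_add_rcancel_nat[of i 1 j d] by simp
    then show "i = j" using ij by (simp add: cong_less_modulus_unique_nat)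
  qed
  have "(\<lambda>i. \<tau> (Suc i)) ` {..<d} = S"
  proof (rule card_subset_eq)
    show "finite S" using Sn finite_subset by blast
    show "card ((\<lambda>i. \<tau> (Suc i)) ` {..<d}) = card S"
      using card_image[OF inj] card_transversal[OF S d0] by simp
  qed (use \<tau>(1) in blast)
  then have "(\<Sum>i<d. Poly_Mapping.single (\<tau> (Suc i)) (1::nat)) = ind_exp S"
    unfolding ind_exp_def using sum.reindex[OF inj, of "\<lambda>s. Poly_Mapping.single s (1::nat)"] by simp
  then have "walk n 0 (A * n) + ind_exp S \<in> power_exps n m C"
    using C(5) by (simp add: A walk_full[of n b0])
  moreover have "C \<le> n" using C(1) dn by (simp add: q_def)
  moreover have "m * C = A * n + d" using A C(2,3) by linarith
  ultimately show ?thesis using that by blast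
qed

section \<open>The threshold exponent \<open>t0\<close> and the final bound\<close>

lemma threshold_solution_neq:
  fixes n m d :: nat
  assumes "n > m" "m > 0" "d = gcd n m" "m * s = \<alpha> * n + d"
  shows "s \<noteq> n"
proof
  assume "s = n"
  then have "n dvd \<alpha> * n + d" using assms(4) by (metis dvd_triv_right)
  \<comment> \<open>This is impossible because \<open>0 < d \<le> m < n\<close>.\<close>
  then have "n dvd d" by (simp add: dvd_add_right_iff)
  moreover have "d \<le> m" "d > 0" using assms by (simp_all add: dvd_imp_le)
  ultimately show False using assms(1) by (auto dest: dvd_imp_le)
qed

text \<open>It ensures that the maximum defining \<open>t0\<close> is attained. If \<open>m\<close>
  divides \<open>n\<close>, then \<open>s = 1\<close> would give \<alpha> = 0, and one more round
  leads to \<open>1 + n div m\<close>; otherwise \<open>d < m\<close> already excludes \<alpha> =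
  0.\<close>

lemma threshold_nonempty:
  fixes n m d :: nat
  assumes n: "n > m" and m: "m \<ge> 2" and d: "d = gcd n m"
  shows "\<exists>s \<alpha>::nat. s \<le> n - 1 \<and> \<alpha> > 0 \<and> m * s = \<alpha> * n + d"
proof (cases "d = m")
  case True
  then obtain q where q: "n = m * q" using d by (metis gcd_dvd1 dvdE)
  have "q \<noteq> 0" "q \<noteq> 1" using n q by auto
  then have q2: "q \<ge> 2" by linarith
  have "2 * q \<le> m * q" using m by (rule mult_le_mono1)
  then have "1 + q \<le> n - 1" using q2 q by linarith
  then show ?thesis
    using True by (intro exI[of _ "1 + q"] exI[of _ 1]) (simp add: q)
next
  case False
  have "d \<le> m" using d m by (intro dvd_imp_le) simp_all
  then have dm: "d < m" "d > 0" using False by (linarith, use d m in simp)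
  have "0 mod gcd n m = d mod gcd n m" by (simp add: d)
  from steps_to_congruent[OF _ this] n obtain L
    where L: "1 \<le> L" "L \<le> n div gcd n m" "(0 + m * L) mod n = d mod n" by auto
  define \<alpha> where "\<alpha> = m * L div n"
  have "(m * L) mod n = d" using L(3) dm n by simp
  then have eq: "m * L = \<alpha> * n + d" by (metis \<alpha>_def div_mult_mod_eq)
  have "L \<noteq> n" using threshold_solution_neq[OF n _ d eq] m by simp
  then have "L \<le> n - 1" using L(2) div_le_dividend[of n "gcd n m"] by linarith
  moreover have "\<alpha> > 0"
  proof (rule ccontr)
    assume "\<not> \<alpha> > 0"
    then have "m * L = d" using eq by simp
    moreover have "m \<le> m * L" using L(1) by simp
    ultimately show False using dm by simp
  qed
  ultimately show ?thesis using eq by blast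
qed

text \<open>The number \<open>C\<close> of generators produced by the walk may depend on
  \<open>S\<close>. Maximality of \<open>t0\<close> gives \<open>C \<le> t0\<close>, and the missing
  generators fill whole rounds, so the other factor becomes the same for all
  \<open>S\<close>.\<close>

lemma power_exps_transversal:
  fixes n m d t0 t \<alpha> :: nat
  assumes n: "n > m" and m: "m \<ge> 2" and d: "d = gcd n m"
    and t0: "m * t0 = \<alpha> * n + d"
    and max: "\<And>s \<beta>::nat. s \<le> n - 1 \<Longrightarrow> \<beta> > 0 \<Longrightarrow> m * s = \<beta> * n + d \<Longrightarrow> s \<le> t0"
    and S: "S \<in> transversals n d"
  shows "walk n 0 (\<alpha> * n) + ind_exp S \<in> power_exps n m t0"
proof -
  have n0: "n > 0" and m0: "m > 0" using n m by simp_all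
  have d0: "d > 0" "d \<le> m" using d n0 m0 by (simp_all add: gcd_le2_nat)
  obtain A C where C: "C \<le> n" "m * C = A * n + d" "walk n 0 (A * n) + ind_exp S \<in> power_exps n m C"
    by (rule ind_exp_walk[OF S d m0 n0])
  have Cn: "C \<le> n - 1" using C(1) threshold_solution_neq[OF n m0 d C(2)] by linarith
  have Ct: "C \<le> t0"
  \<comment> \<open>Maximality only concerns positive multiples of \<open>n\<close>. For
    \<open>A = 0\<close>, \<open>m * C = d \<le> m\<close> leaves \<open>C \<le> 1\<close>, while
    \<open>t0\<close> is positive.\<close>
  proof (cases "A = 0")
    case True
    have "C \<le> 1"
    proof (rule ccontr)
      assume "\<not> C \<le> 1"
      then have "m * 2 \<le> m * C" by (intro mult_le_mono2) simp
      then show False using True C(2) d0 m0 by simp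
    qed
    moreover have "t0 \<noteq> 0" using t0 d0 by (intro notI) simp
    ultimately show ?thesis by linarith
  qed (use max[OF Cn _ C(2)] in simp)
  have "m * C \<le> m * t0" using Ct by simp
  then have "A * n \<le> \<alpha> * n" using C(2) t0 by linarith
  then have A: "A \<le> \<alpha>" using n0 by simp
  \<comment> \<open>The two equations differ by a multiple of \<open>n\<close>, so the remaining
    generators make up exactly \<open>\<alpha> - A\<close> rounds.\<close>
  have "m * (t0 - C) = (\<alpha> - A) * n"
    using t0 C(2) by (simp add: diff_mult_distrib diff_mult_distrib2)
  then have "walk n (A * n) ((\<alpha> - A) * n) \<in> power_exps n m (t0 - C)"
    using power_exps_walk[OF n0, of "A * n" m "t0 - C"] by simp
  from power_exps_add[OF C(3) this] Ct
  have "walk n 0 (A * n) + ind_exp S + walk n (A * n) ((\<alpha> - A) * n) \<in> power_exps n m t0" by simp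
  moreover have "walk n 0 (\<alpha> * n) = walk n 0 (A * n) + walk n (A * n) ((\<alpha> - A) * n)"
    using walk_add[of n 0 "A * n" "(\<alpha> - A) * n"] A by (simp add: diff_mult_distrib)
  ultimately show ?thesis by (simp add: add_ac)
qed

theorem theorem4p5:
  fixes n m d t0 t :: nat
  assumes "n > m" and "m \<ge> 2"
    and "d = gcd n m"
    and "t0 = Max {s. s \<le> n - 1 \<and> (\<exists>\<alpha>::nat. \<alpha> > 0 \<and> m * s = \<alpha> * n + d)}"
    and "t \<ge> t0"
  shows "sdepth_ideal n (ideal_power n (cycle_path_ideal n m :: 'k::field mpoly set) t)
           \<le> (n + d) div 2"
proof -
  have n0: "n > 0" and m0: "m > 0" using assms(1,2) by simp_all
  have d: "0 < d" "d \<le> n" using assms(1-3) n0 by (simp_all add: gcd_le1_nat)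
  let ?X = "{s. s \<le> n - 1 \<and> (\<exists>\<alpha>::nat. \<alpha> > 0 \<and> m * s = \<alpha> * n + d)}"
  have finX: "finite ?X" by (rule finite_subset[of _ "{..n - 1}"]) auto
  have "?X \<noteq> {}" using threshold_nonempty[OF assms(1-3)] by blast
  then have "t0 \<in> ?X" unfolding assms(4) by (rule Max_in[OF finX])
  then obtain \<alpha> where \<alpha>: "m * t0 = \<alpha> * n + d" by blast
  have max: "s \<le> t0" if "s \<le> n - 1" "\<beta> > 0" "m * s = \<beta> * n + d" for s \<beta>
    unfolding assms(4) using that by (intro Max_ge[OF finX]) blast
  \<comment> \<open>The rounds have degree \<open>m * t0 - d\<close>; the second walk supplies
    \<open>t - t0\<close> further generators, for a total degree of
    \<open>m * t - d\<close>.\<close>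
  define w where "w = walk n 0 (\<alpha> * n) + walk n 0 (m * (t - t0))"
  let ?U = "power_exps n m t"
  let ?I = "span_exps ?U :: 'k mpoly set"
  let ?dec = "stanley_decomposition n (ideal_module (poly_ring n) ?I) (std_grading ?I)"
  have mem: "w + ind_exp S \<in> ?U" if "S \<in> transversals n d" for S
  proof -
    have "walk n 0 (\<alpha> * n) + ind_exp S + walk n 0 (m * (t - t0)) \<in> power_exps n m (t0 + (t - t0))"
      using power_exps_transversal[OF assms(1-3) \<alpha> max that] power_exps_walk[OF n0]
      by (rule power_exps_add)
    then show ?thesis using assms(5) by (simp add: w_def add_ac)
  qed
  have nonmem: "w + ind_exp T \<notin> ?U" if S: "S \<in> transversals n d" and T: "T \<subset> S" for S T
  proof
    have Sn: "S \<subseteq> {1..n}" using S by (simp add: transversals_def)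
    then have Tn: "T \<subseteq> {1..n}" using T by blast
    assume "w + ind_exp T \<in> ?U"
    then have "m * t \<le> exp_degree n (w + ind_exp T)" by (rule exp_degree_power_exps[OF n0])
    also have "exp_degree n (w + ind_exp T) = \<alpha> * n + m * (t - t0) + card T"
      by (simp add: w_def exp_degree_add exp_degree_walk[OF n0] exp_degree_ind_exp[OF Tn])
    also have "card T < d"
      using psubset_card_mono[OF finite_subset[OF Sn] T] card_transversal[OF S d(1)] by simp
    \<comment> \<open>With fewer than \<open>d\<close> additional variables the degree stays below
      \<open>m * t\<close>, the least degree in the power.\<close>
    finally have "m * t < m * t0 + m * (t - t0)" unfolding \<alpha> by linarith
    then show False using assms(5) by (simp add: diff_mult_distrib2)
  qed
  have bound: "sdepth_decomposition D \<le> (n + d) div 2" if D: "?dec D" for D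
  proof -
    let ?Z = "\<lambda>i. snd (D ! i)"
    obtain a where a: "(\<Union>i<length D. exp_cell (a i) (?Z i)) = ?U"
      "disjoint_family_on (\<lambda>i. exp_cell (a i) (?Z i)) {..<length D}"
      using stanley_decomposition_exps[OF ideal_span_power_exps[OF n0] D] by blast
    have Zn: "?Z i \<subseteq> {1..n}" if "i < length D" for i
      using D nth_mem[OF that] unfolding stanley_decomposition_def by (auto simp: split_beta)
    have Zk: "sdepth_decomposition D \<le> card (?Z i)" if "i < length D" for i
      unfolding sdepth_decomposition_def
      by (rule Min_le) (use nth_mem[OF that] in \<open>auto simp: split_beta image_iff\<close>)
    have "2 * sdepth_decomposition D \<le> n + d"
      by (rule exp_cell_bound[OF d a Zn Zk mem nonmem])
    then show ?thesis by linarith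
  qed
  have "\<exists>D. ?dec D" by (rule stanley_decomposition_exists[OF n0]) (use assms(1) in simp)
  then have "{sdepth_decomposition D | D. ?dec D} \<noteq> {}" by blast
  \<comment> \<open>The upper bound also makes the set of values finite, as the rule for
    \<open>Max\<close> requires.\<close>
  moreover have "{sdepth_decomposition D | D. ?dec D} \<subseteq> {..(n + d) div 2}" using bound by blast
  ultimately have "Max {sdepth_decomposition D | D. ?dec D} \<le> (n + d) div 2"
    using bound by (subst Max_le_iff) (auto intro: finite_subset)
  then show ?thesis unfolding ideal_power_eq[OF n0] sdepth_ideal_def sdepth_def .
qed

end
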